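(* Let $\mathbf H$ be a cocommutative Hopf monoid in vector species, $K$ a finite set and $k\in K$. Define $$\Psi_{(k,K)}=\sum_{\substack{J=(J_1,\dots,J_\ell)\models K\\ k\in J_1}}(-1)^{\ell-1}m_J\circ\Delta_J:\mathbf H[K]\to\mathbf H[K].$$ Then $\Psi_{(k,K)}$ maps $\mathbf H[K]$ into the space $\mathcal P(\mathbf H)[K]$ of primitive elements and restricts to the identity on $\mathcal P(\mathbf H)[K]$; that is, $\Psi_{(k,K)}$ is a projection of $\mathbf H[K]$ onto $\mathcal P(\mathbf H)[K]$.
   Context: A Hopf monoid in vector species (Aguiar–Mahajan) consists of vector spaces $\mathbf H[K]$ for finite sets $K$, natural in bijections, with products $m_{I,J}:\mathbf H[I]\otimes\mathbf H[J]\to\mathbf H[I\sqcup J]$ and coproducts $\Delta_{I,J}:\mathbf H[I\sqcup J]\to\mathbf H[I]\otimes\mathbf H[J]$ satisfying associativity, coassociativity, unit/counit and compatibility axioms; it is cocommutative if $\Delta_{J,I}$ equals $\Delta_{I,J}$ followed by the braiding. A set composition $J=(J_1,\dots,J_\ell)\models K$ is a sequence of nonempty pairwise disjoint sets with union $K$. $\Delta_{(K)}=\mathrm{id}$, $\Delta_J=(\Delta_{J_1,J_2}\otimes\mathrm{id}\otimes\cdots\otimes\mathrm{id})\circ\cdots\circ\Delta_{K\setminus J_\ell,J_\ell}$ and $m_{(K)}=\mathrm{id}$, $m_J=m_{K\setminus J_\ell,J_\ell}\circ\cdots\circ(m_{J_1,J_2}\otimes\mathrm{id}\otimes\cdots\otimes\mathrm{id})$.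 The primitives are $\mathcal P(\mathbf H)[K]=\{x\in\mathbf H[K]:\Delta_{I,J}(x)=0\text{ for all }(I,J)\models K\}$.
   Formalization: The Hopf monoid is assumed connected (H[∅] is the ground field via the unit); without this the claim fails, e.g. for the constant species kG with Δ(g)=g⊗g and m(g⊗h)=gh, where Ψ(g)=g−g² is not primitive on a two-element set. *)

theory Defs
  imports Complex_Main "HOL-Library.Function_Algebras"
begin

section \<open>Tensor products of subspaces\<close>

text \<open>
  All vector spaces in play are subspaces of one ambient space \<open>'v\<close> over an arbitrary field
  \<open>'f\<close>.  This loses no generality: any family of vector spaces embeds into its direct sum.

  A tensor is encoded as a functional on forms.  A multilinear form on lists is a family of
  \<open>n\<close>-linear forms, one for every \<open>n\<close>, and the pure tensor of a list is evaluation at that list.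
  Over a field this is a model of the tensor algebra of \<open>'v\<close>; the tensor product of
  \<open>[U\<^sub>1, \<dots>, U\<^sub>n]\<close> is the span of the pure tensors with entries in the \<open>U\<^sub>i\<close>.  The lemmas
  \<open>tensor_lift\<close> and \<open>tensor_space_ext\<close> below are its universal property.
  In this model the associativity constraints are identities, and the empty
  tensor product is the ground field.
\<close>

type_synonym ('f, 'v) tensor = "('v list \<Rightarrow> 'f) \<Rightarrow> 'f"

definition tscale :: "'f::field \<Rightarrow> ('f, 'v) tensor \<Rightarrow> ('f, 'v) tensor" where
  "tscale c t = (\<lambda>b. c * t b)"

global_interpretation tensor: vector_space "tscale :: 'f::field \<Rightarrow> ('f, 'v) tensor \<Rightarrow> ('f, 'v) tensor"
  by unfold_locales (auto simp: tscale_def fun_eq_iff algebra_simps)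

definition linear_map_on ::
  "('f::field \<Rightarrow> 'u::ab_group_add \<Rightarrow> 'u) \<Rightarrow> ('f \<Rightarrow> 'w::ab_group_add \<Rightarrow> 'w)
    \<Rightarrow> 'u set \<Rightarrow> 'w set \<Rightarrow> ('u \<Rightarrow> 'w) \<Rightarrow> bool" where
  "linear_map_on s s' U W f \<longleftrightarrow>
     f ` U \<subseteq> W \<and>
     (\<forall>x\<in>U. \<forall>y\<in>U. f (x + y) = f x + f y) \<and>
     (\<forall>c. \<forall>x\<in>U. f (s c x) = s' c (f x))"

definition projection_onto ::
  "('f::field \<Rightarrow> 'u::ab_group_add \<Rightarrow> 'u) \<Rightarrow> 'u set \<Rightarrow> 'u set \<Rightarrow> ('u \<Rightarrow> 'u) \<Rightarrow> bool" where
  "projection_onto s U P p \<longleftrightarrow>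
     linear_map_on s s U U p \<and> p ` U = P \<and> (\<forall>x\<in>U. p (p x) = p x)"

locale tensors = vector_space scale
  for scale :: "'f::field \<Rightarrow> 'v::ab_group_add \<Rightarrow> 'v" (infixr \<open>*s\<close> 75)
begin

definition multilinear_form :: "('v list \<Rightarrow> 'f) \<Rightarrow> bool" where
  "multilinear_form b \<longleftrightarrow> (\<forall>xs ys. Vector_Spaces.linear scale (*) (\<lambda>x. b (xs @ x # ys)))"

definition pure_tensor :: "'v list \<Rightarrow> ('f, 'v) tensor" where
  "pure_tensor xs = (\<lambda>b. if multilinear_form b then b xs else 0)"

definition tensor_space :: "'v set list \<Rightarrow> ('f, 'v) tensor set" where
  "tensor_space Us = tensor.span (pure_tensor ` listset Us)"

definition multilinear_on ::
  "('f \<Rightarrow> 'w::ab_group_add \<Rightarrow> 'w) \<Rightarrow> 'v set list \<Rightarrow> ('v list \<Rightarrow> 'w) \<Rightarrow> bool" where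
  "multilinear_on s Us f \<longleftrightarrow>
     (\<forall>Us1 U Us2 xs ys. Us = Us1 @ U # Us2 \<longrightarrow> xs \<in> listset Us1 \<longrightarrow> ys \<in> listset Us2 \<longrightarrow>
        linear_map_on scale s U UNIV (\<lambda>x. f (xs @ x # ys)))"

lemma multilinear_pure_tensor: "multilinear_on tscale Us pure_tensor"
  by (auto simp: multilinear_on_def linear_map_on_def pure_tensor_def multilinear_form_def
      tscale_def fun_eq_iff Vector_Spaces.linear_iff)

lemma tensor_space_ext:
  assumes h: "linear_map_on tscale s (tensor_space Us) UNIV h"
    and h': "linear_map_on tscale s (tensor_space Us) UNIV h'"
    and eq: "\<And>xs. xs \<in> listset Us \<Longrightarrow> h (pure_tensor xs) = h' (pure_tensor xs)"
    and t: "t \<in> tensor_space Us"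
  shows "h t = h' t"
proof -
  let ?S = "{t \<in> tensor_space Us. h t = h' t}"
  have zero: "0 \<in> tensor_space Us"
    by (simp add: tensor_space_def tensor.span_zero)
  have "h (0 + 0) = h 0 + h 0" "h' (0 + 0) = h' 0 + h' 0"
    using h h' zero unfolding linear_map_on_def by blast+
  then have "h 0 = h' 0" by simp
  then have "tensor.subspace ?S"
    using h h' zero
    by (auto simp: tensor.subspace_def linear_map_on_def tensor_space_def
        tensor.span_add tensor.span_scale)
  moreover have "pure_tensor ` listset Us \<subseteq> ?S"
    using eq by (auto simp: tensor_space_def tensor.span_base)
  ultimately have "tensor_space Us \<subseteq> ?S"
    unfolding tensor_space_def by (rule tensor.span_minimal[rotated])
  then show ?thesis using t by blast
qed

lemma multilinear_extend:
  assumes s: "vector_space s"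
    and sub: "\<And>U. U \<in> set Us \<Longrightarrow> subspace U"
    and f: "multilinear_on s Us f"
  obtains g where "\<And>zs. zs \<in> listset Us \<Longrightarrow> g zs = f zs"
    and "\<And>xs ys. Vector_Spaces.linear scale s (\<lambda>x. g (xs @ x # ys))"
proof -
  interpret s: vector_space s by fact
  interpret vector_space_pair scale scale by unfold_locales
  have "\<exists>p. Vector_Spaces.linear scale scale p \<and> range p \<subseteq> U \<and> (\<forall>v\<in>U. p v = v)" if "U \<in> set Us" for U
    using linear_exists_left_inverse_on[of id U] sub[OF that] by (auto simp: linear_id)
  then obtain p where p: "\<And>U. U \<in> set Us \<Longrightarrow>
      Vector_Spaces.linear scale scale (p U) \<and> range (p U) \<subseteq> U \<and> (\<forall>v\<in>U. p U v = v)"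
    by metis
  define g where "g zs = (if length zs = length Us then f (map2 p Us zs) else 0)" for zs
  have in_ls: "map2 p Vs zs \<in> listset Vs" if "length zs = length Vs" "set Vs \<subseteq> set Us" for Vs zs
    using that
  proof (induction zs Vs rule: list_induct2)
    case (Cons z zs V Vs)
    then have "p V z \<in> V" using p[of V] by auto
    with Cons show ?case by (auto simp: set_Cons_def)
  qed simp
  have id_ls: "length zs = length Vs \<and> map2 p Vs zs = zs"
    if "zs \<in> listset Vs" "set Vs \<subseteq> set Us" for Vs zs
    using that
  proof (induction Vs arbitrary: zs)
    case (Cons V Vs)
    then obtain x ys where "zs = x # ys" "x \<in> V" "ys \<in> listset Vs" by (auto simp: set_Cons_def)
    with Cons show ?case using p[of V] by auto
  qed simp
  show thesis
  proof (rule that[of g])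
    fix zs assume "zs \<in> listset Us"
    then show "g zs = f zs" using id_ls[of zs Us] by (simp add: g_def)
  next
    fix xs ys
    show "Vector_Spaces.linear scale s (\<lambda>x. g (xs @ x # ys))"
    proof (cases "length xs + Suc (length ys) = length Us")
      case False
      then have "(\<lambda>x. g (xs @ x # ys)) = (\<lambda>_. 0)" by (auto simp: g_def)
      moreover have "vector_space_pair scale s" by unfold_locales
      ultimately show ?thesis by (simp add: vector_space_pair.linear_zero)
    next
      case True
      define A where "A = take (length xs) Us"
      define U where "U = Us ! length xs"
      define B where "B = drop (Suc (length xs)) Us"
      have Us: "Us = A @ U # B"
        using True by (simp add: A_def U_def B_def id_take_nth_drop[symmetric])
      have len: "length xs = length A" "length ys = length B" using True by (auto simp: A_def B_def)
      have PA: "map2 p A xs \<in> listset A" and PB: "map2 p B ys \<in> listset B"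
        using in_ls[of xs A] in_ls[of ys B] len Us by auto
      have lin: "linear_map_on scale s U UNIV (\<lambda>x. f (map2 p A xs @ x # map2 p B ys))"
        using f PA PB Us unfolding multilinear_on_def by blast
      have pU: "Vector_Spaces.linear scale scale (p U)" "\<And>x. p U x \<in> U"
        using p[of U] Us by auto
      interpret pU: Vector_Spaces.linear scale scale "p U" by (rule pU)
      have "g (xs @ x # ys) = f (map2 p A xs @ p U x # map2 p B ys)" for x
        using True len by (simp add: g_def Us)
      then show ?thesis
        using lin pU(2)
        by (simp add: Vector_Spaces.linear_iff vector_space_axioms s pU.add pU.scale linear_map_on_def)
    qed
  qed
qed

lemma tensor_lift:
  assumes s: "vector_space s"
    and sub: "\<And>U. U \<in> set Us \<Longrightarrow> subspace U"
    and f: "multilinear_on s Us f"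
  shows "\<exists>h. linear_map_on tscale s (tensor_space Us) UNIV h \<and>
             (\<forall>xs\<in>listset Us. h (pure_tensor xs) = f xs)"
proof -
  interpret s: vector_space s by fact
  interpret ts: vector_space_pair tscale s by unfold_locales
  interpret sf: vector_space_pair s "(*)" by unfold_locales (auto simp: algebra_simps)
  obtain g where g: "\<And>zs. zs \<in> listset Us \<Longrightarrow> g zs = f zs"
    and g_lin: "\<And>xs ys. Vector_Spaces.linear scale s (\<lambda>x. g (xs @ x # ys))"
    using multilinear_extend[OF s sub f] by blast
  obtain B :: "('f, 'v) tensor set" where B: "B \<subseteq> range pure_tensor" "tensor.independent B" "range pure_tensor \<subseteq> tensor.span B"
    by (fact tensor.maximal_independent_subset[of "range pure_tensor"])
  define r where "r = inv pure_tensor"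
  have r: "pure_tensor (r b) = b" if "b \<in> B" for b
    unfolding r_def using that B(1) by (intro f_inv_into_f) blast
  obtain h where h: "Vector_Spaces.linear tscale s h" "\<And>b. b \<in> B \<Longrightarrow> h b = g (r b)"
    using ts.linear_independent_extend[OF B(2), of "g \<circ> r"] by auto
  interpret h: Vector_Spaces.linear tscale s h by (rule h)
  have main: "h (pure_tensor zs) = g zs" for zs
  proof -
    have "pure_tensor zs \<in> tensor.span B" using B(3) by blast
    then obtain t c where t: "finite t" "t \<subseteq> B" "(\<Sum>b\<in>t. tscale (c b) b) = pure_tensor zs"
      by (auto simp: tensor.span_explicit)
    have hz: "h (pure_tensor zs) = (\<Sum>b\<in>t. s (c b) (g (r b)))"
      unfolding t(3)[symmetric] h.sum h.scale using t(2) h(2) by (intro sum.cong) auto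
    have "\<phi> (h (pure_tensor zs) - g zs) = 0" if \<phi>: "Vector_Spaces.linear s (*) \<phi>" for \<phi>
    proof -
      interpret \<phi>: Vector_Spaces.linear s "(*)" \<phi> by (rule \<phi>)
      have ml: "multilinear_form (\<phi> \<circ> g)"
        unfolding multilinear_form_def
        using Vector_Spaces.linear_compose[OF g_lin \<phi>] by (simp add: o_def)
      have "\<phi> (h (pure_tensor zs)) = (\<Sum>b\<in>t. c b * \<phi> (g (r b)))"
        by (simp add: hz \<phi>.sum \<phi>.scale)
      also have "\<dots> = (\<Sum>b\<in>t. c b * b (\<phi> \<circ> g))"
      proof (rule sum.cong)
        fix b assume "b \<in> t"
        then have "b (\<phi> \<circ> g) = pure_tensor (r b) (\<phi> \<circ> g)" using r t(2) by (metis subsetD)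
        then show "c b * \<phi> (g (r b)) = c b * b (\<phi> \<circ> g)" using ml by (simp add: pure_tensor_def)
      qed simp
      also have "\<dots> = (\<Sum>b\<in>t. tscale (c b) b) (\<phi> \<circ> g)"
        using t(1) by (induction t rule: finite_induct) (auto simp: tscale_def)
      also have "\<dots> = \<phi> (g zs)"
        using ml by (simp add: t(3) pure_tensor_def)
      finally show ?thesis by (simp add: \<phi>.diff)
    qed
    note sep = this
    show ?thesis
    proof (rule ccontr)
      assume "h (pure_tensor zs) \<noteq> g zs"
      then have "s.independent {h (pure_tensor zs) - g zs}" by simp
      then obtain \<phi> where \<phi>: "Vector_Spaces.linear s (*) \<phi>" "\<phi> (h (pure_tensor zs) - g zs) = 1"
        using sf.linear_independent_extend[of _ "\<lambda>_. 1"] by blast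
      then show False using sep[OF \<phi>(1)] by simp
    qed
  qed
  then have "linear_map_on tscale s (tensor_space Us) UNIV h \<and>
             (\<forall>xs\<in>listset Us. h (pure_tensor xs) = f xs)"
    by (auto simp: linear_map_on_def h.add h.scale g)
  then show ?thesis by blast
qed

text \<open>The linear map out of a tensor product induced by a multilinear map \<open>f\<close>; it is determined
  on \<open>tensor_space Us\<close> only.\<close>

definition tensor_induced ::
  "('f \<Rightarrow> 'w::ab_group_add \<Rightarrow> 'w) \<Rightarrow> 'v set list \<Rightarrow> ('v list \<Rightarrow> 'w) \<Rightarrow> ('f, 'v) tensor \<Rightarrow> 'w" where
  "tensor_induced s Us f =
     (SOME h. linear_map_on tscale s (tensor_space Us) UNIV h \<and>
              (\<forall>xs\<in>listset Us. h (pure_tensor xs) = f xs))"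

lemma
  assumes "vector_space s" and "\<And>U. U \<in> set Us \<Longrightarrow> subspace U" and "multilinear_on s Us f"
  shows tensor_induced_linear: "linear_map_on tscale s (tensor_space Us) UNIV (tensor_induced s Us f)"
    and tensor_induced_pure: "\<And>xs. xs \<in> listset Us \<Longrightarrow> tensor_induced s Us f (pure_tensor xs) = f xs"
  using someI_ex[OF tensor_lift[OF assms]] unfolding tensor_induced_def by blast+

text \<open>Concatenation of tensors, \<open>(x\<^sub>1 \<otimes> \<dots> \<otimes> x\<^sub>m, y\<^sub>1 \<otimes> \<dots> \<otimes> y\<^sub>n) \<mapsto> x\<^sub>1 \<otimes> \<dots> \<otimes> x\<^sub>m \<otimes> y\<^sub>1 \<otimes> \<dots> \<otimes> y\<^sub>n\<close>.\<close>

definition tensor_times :: "('f, 'v) tensor \<Rightarrow> ('f, 'v) tensor \<Rightarrow> ('f, 'v) tensor" (infixr \<open>\<otimes>\<close> 70) where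
  "t \<otimes> u = (\<lambda>b. if multilinear_form b then t (\<lambda>xs. u (\<lambda>ys. b (xs @ ys))) else 0)"

lemma pure_tensor_times: "pure_tensor xs \<otimes> pure_tensor ys = pure_tensor (xs @ ys)"
proof
  fix b
  show "(pure_tensor xs \<otimes> pure_tensor ys) b = pure_tensor (xs @ ys) b"
  proof (cases "multilinear_form b")
    case True
    have "multilinear_form (\<lambda>ys. b (xs @ ys))" for xs
      unfolding multilinear_form_def
    proof (intro allI)
      fix us vs
      show "Vector_Spaces.linear scale (*) (\<lambda>x. b (xs @ us @ x # vs))"
        using True[unfolded multilinear_form_def, rule_format, of "xs @ us" vs] by simp
    qed
    moreover have "multilinear_form (\<lambda>xs. b (xs @ ys))"
      using True unfolding multilinear_form_def by simp
    ultimately show ?thesis using True by (simp add: tensor_times_def pure_tensor_def)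
  qed (simp add: tensor_times_def pure_tensor_def)
qed

text \<open>\<open>tensor_map Us Vs f g\<close> is \<open>f \<otimes> g\<close> on \<open>tensor_space (Us @ Vs)\<close>, where \<open>f\<close> is defined on
  \<open>tensor_space Us\<close> and \<open>g\<close> on \<open>tensor_space Vs\<close>.\<close>

definition tensor_map ::
  "'v set list \<Rightarrow> 'v set list \<Rightarrow> (('f, 'v) tensor \<Rightarrow> ('f, 'v) tensor)
    \<Rightarrow> (('f, 'v) tensor \<Rightarrow> ('f, 'v) tensor) \<Rightarrow> ('f, 'v) tensor \<Rightarrow> ('f, 'v) tensor" where
  "tensor_map Us Vs f g =
     tensor_induced tscale (Us @ Vs)
       (\<lambda>zs. f (pure_tensor (take (length Us) zs)) \<otimes> g (pure_tensor (drop (length Us) zs)))"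

lemma tensor_space_induct [consumes 1, case_names zero add scale pure]:
  assumes "t \<in> tensor_space Us" and "P 0"
    and add: "\<And>t u. t \<in> tensor_space Us \<Longrightarrow> u \<in> tensor_space Us \<Longrightarrow> P t \<Longrightarrow> P u \<Longrightarrow> P (t + u)"
    and scale: "\<And>c t. t \<in> tensor_space Us \<Longrightarrow> P t \<Longrightarrow> P (tscale c t)"
    and "\<And>xs. xs \<in> listset Us \<Longrightarrow> P (pure_tensor xs)"
  shows "P t"
proof -
  have "tensor.subspace {t \<in> tensor_space Us. P t}"
    using \<open>P 0\<close> add scale
    by (auto simp: tensor.subspace_def tensor_space_def tensor.span_zero tensor.span_add
        tensor.span_scale)
  moreover have "pure_tensor ` listset Us \<subseteq> {t \<in> tensor_space Us. P t}"
    using assms(5) by (auto simp: tensor_space_def tensor.span_base)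
  ultimately have "tensor_space Us \<subseteq> {t \<in> tensor_space Us. P t}"
    unfolding tensor_space_def by (rule tensor.span_minimal[rotated])
  then show ?thesis using assms(1) by blast
qed

lemma multilinear_form_tensor_left:
  assumes "multilinear_form b" and "u \<in> tensor_space Vs"
  shows "multilinear_form (\<lambda>xs. u (\<lambda>ys. b (xs @ ys)))"
  using assms(2)
proof (induction rule: tensor_space_induct)
  case (pure zs)
  have "multilinear_form (\<lambda>ys. b (xs @ ys))" for xs
    unfolding multilinear_form_def
  proof (intro allI)
    fix us vs
    show "Vector_Spaces.linear scale (*) (\<lambda>x. b (xs @ us @ x # vs))"
      using assms(1)[unfolded multilinear_form_def, rule_format, of "xs @ us" vs] by simp
  qed
  then show ?case
    using assms(1) by (simp add: pure_tensor_def multilinear_form_def)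
qed (use assms(1) in \<open>auto simp: multilinear_form_def Vector_Spaces.linear_iff tscale_def algebra_simps\<close>)

lemma tensor_eval_linear:
  assumes "t \<in> tensor_space Us" and "multilinear_form b" and "multilinear_form b'"
  shows "t (\<lambda>xs. b xs + b' xs) = t b + t b'" and "t (\<lambda>xs. c * b xs) = c * t b"
proof -
  have ml: "multilinear_form (\<lambda>xs. b xs + b' xs)" "multilinear_form (\<lambda>xs. c * b xs)"
    using assms(2,3) by (auto simp: multilinear_form_def Vector_Spaces.linear_iff algebra_simps)
  show "t (\<lambda>xs. b xs + b' xs) = t b + t b'"
    using assms(1) by (induction rule: tensor_space_induct)
      (use ml assms in \<open>auto simp: tscale_def pure_tensor_def algebra_simps\<close>)
  show "t (\<lambda>xs. c * b xs) = c * t b"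
    using assms(1) by (induction rule: tensor_space_induct)
      (use ml assms in \<open>auto simp: tscale_def pure_tensor_def algebra_simps\<close>)
qed

lemma tensor_times_linear:
  shows "(t + t') \<otimes> u = t \<otimes> u + t' \<otimes> u" and "tscale c t \<otimes> u = tscale c (t \<otimes> u)"
    and "t \<in> tensor_space Us \<Longrightarrow> u \<in> tensor_space Vs \<Longrightarrow> u' \<in> tensor_space Vs \<Longrightarrow>
      t \<otimes> (u + u') = t \<otimes> u + t \<otimes> u'"
    and "t \<in> tensor_space Us \<Longrightarrow> u \<in> tensor_space Vs \<Longrightarrow> t \<otimes> tscale c u = tscale c (t \<otimes> u)"
  by (auto simp: tensor_times_def tscale_def fun_eq_iff tensor_eval_linear[of t Us]
      multilinear_form_tensor_left)

lemma multilinear_tensor_map: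
  assumes f: "linear_map_on tscale tscale (tensor_space Us) (tensor_space Us') f"
    and g: "linear_map_on tscale tscale (tensor_space Vs) (tensor_space Vs') g"
  shows "multilinear_on tscale (Us @ Vs)
    (\<lambda>zs. f (pure_tensor (take (length Us) zs)) \<otimes> g (pure_tensor (drop (length Us) zs)))"
  unfolding multilinear_on_def
proof (intro allI impI)
  fix A U B xs ys
  assume eq: "Us @ Vs = A @ U # B" and xs: "xs \<in> listset A" and ys: "ys \<in> listset B"
  have len: "length zs = length Ws" if "zs \<in> listset Ws" for zs :: "'v list" and Ws
    using that by (induction Ws arbitrary: zs) (auto simp: set_Cons_def)
  have app: "zs @ zs' \<in> listset (Ws @ Ws')" if "zs \<in> listset Ws" "zs' \<in> listset Ws'"
    for zs zs' :: "'v list" and Ws Ws'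
    using that by (induction Ws arbitrary: zs) (auto simp: set_Cons_def)
  have split: "\<exists>zs1 zs2. zs = zs1 @ zs2 \<and> zs1 \<in> listset Ws \<and> zs2 \<in> listset Ws'"
    if "zs \<in> listset (Ws @ Ws')" for zs :: "'v list" and Ws Ws'
    using that
  proof (induction Ws arbitrary: zs)
    case (Cons W Ws)
    then obtain z zs0 where z: "zs = z # zs0" "z \<in> W" "zs0 \<in> listset (Ws @ Ws')"
      by (auto simp: set_Cons_def)
    then obtain zs1 zs2 where "zs0 = zs1 @ zs2" "zs1 \<in> listset Ws" "zs2 \<in> listset Ws'"
      using Cons.IH by blast
    then show ?case using z by (intro exI[of _ "z # zs1"] exI[of _ zs2]) (auto simp: set_Cons_def)
  qed simp
  have in_space: "pure_tensor zs \<in> tensor_space Ws" if "zs \<in> listset Ws" for zs Ws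
    using that by (simp add: tensor_space_def tensor.span_base)
  have ml: "pure_tensor (us @ (x + y) # vs) = pure_tensor (us @ x # vs) + pure_tensor (us @ y # vs)"
    "pure_tensor (us @ (c *s x) # vs) = tscale c (pure_tensor (us @ x # vs))" for us vs x y c
    by (auto simp: pure_tensor_def multilinear_form_def tscale_def fun_eq_iff
        Vector_Spaces.linear_iff)
  note lin = f[unfolded linear_map_on_def image_subset_iff] g[unfolded linear_map_on_def image_subset_iff]
  consider (left) C where "Us = A @ U # C" "B = C @ Vs" | (right) C where "A = Us @ C" "Vs = C @ U # B"
    using eq by (auto simp: append_eq_append_conv2 append_eq_Cons_conv Cons_eq_append_conv)
  then show "linear_map_on scale tscale U UNIV (\<lambda>x. f (pure_tensor (take (length Us) (xs @ x # ys)))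
      \<otimes> g (pure_tensor (drop (length Us) (xs @ x # ys))))"
  proof cases
    case left
    then obtain ys1 ys2 where y: "ys = ys1 @ ys2" "ys1 \<in> listset C" "ys2 \<in> listset Vs"
      using split ys by blast
    have tk: "take (length Us) (xs @ x # ys) = xs @ x # ys1" "drop (length Us) (xs @ x # ys) = ys2" for x
      using len[OF xs] len[OF y(2)] left y(1) by simp_all
    have "xs @ x # ys1 \<in> listset Us" if "x \<in> U" for x
      using app[OF xs, of "x # ys1" "U # C"] that y(2) left(1) by (auto simp: set_Cons_def)
    note mem = in_space[OF this]
    show ?thesis
      unfolding tk linear_map_on_def ml
      using lin mem by (auto simp: tensor_times_linear(1,2))
  next
    case right
    then obtain xs1 xs2 where x: "xs = xs1 @ xs2" "xs1 \<in> listset Us" "xs2 \<in> listset C"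
      using split xs by blast
    have tk: "take (length Us) (xs @ x # ys) = xs1" "drop (length Us) (xs @ x # ys) = xs2 @ x # ys" for x
      using len[OF x(2)] x(1) by simp_all
    have "xs2 @ x # ys \<in> listset Vs" if "x \<in> U" for x
      using app[OF x(3), of "x # ys" "U # B"] that ys right(2) by (auto simp: set_Cons_def)
    note mem = in_space[OF this]
    show ?thesis
      unfolding tk linear_map_on_def ml
      using lin mem in_space[OF x(2)]
      by (auto simp: tensor_times_linear(3,4)[where Us = Us' and Vs = Vs'])
  qed
qed

lemma
  assumes "\<And>U. U \<in> set (Us @ Vs) \<Longrightarrow> subspace U"
    and "linear_map_on tscale tscale (tensor_space Us) (tensor_space Us') f"
    and "linear_map_on tscale tscale (tensor_space Vs) (tensor_space Vs') g"
  shows tensor_map_linear: "linear_map_on tscale tscale (tensor_space (Us @ Vs)) UNIV (tensor_map Us Vs f g)"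
    and tensor_map_pure: "\<And>xs ys. xs @ ys \<in> listset (Us @ Vs) \<Longrightarrow> length xs = length Us \<Longrightarrow>
      tensor_map Us Vs f g (pure_tensor (xs @ ys)) = f (pure_tensor xs) \<otimes> g (pure_tensor ys)"
  unfolding tensor_map_def
  using tensor_induced_linear[OF tensor.vector_space_axioms assms(1) multilinear_tensor_map[OF assms(2,3)]]
    tensor_induced_pure[OF tensor.vector_space_axioms assms(1) multilinear_tensor_map[OF assms(2,3)]]
  by auto

definition braiding :: "'v set \<Rightarrow> 'v set \<Rightarrow> ('f, 'v) tensor \<Rightarrow> ('f, 'v) tensor" where
  "braiding U V = tensor_induced tscale [U, V] (\<lambda>zs. pure_tensor (rev zs))"

text \<open>The identification of a space \<open>U\<close> with the one-fold tensor product \<open>tensor_space [U]\<close>.\<close>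

definition vec :: "'v \<Rightarrow> ('f, 'v) tensor" where
  "vec x = pure_tensor [x]"

definition unvec :: "('f, 'v) tensor \<Rightarrow> 'v" where
  "unvec t = (THE x. vec x = t)"

lemma inj_vec: "inj vec"
proof (rule injI)
  fix x y :: 'v
  assume "vec x = vec y"
  moreover have "multilinear_on scale [UNIV] hd"
    by (auto simp: multilinear_on_def linear_map_on_def Cons_eq_append_conv)
  ultimately show "x = y"
    using tensor_induced_pure[OF vector_space_axioms, of "[UNIV]" hd "[x]"]
      tensor_induced_pure[OF vector_space_axioms, of "[UNIV]" hd "[y]"]
    by (simp add: vec_def set_Cons_def)
qed

lemma unvec_vec [simp]: "unvec (vec x) = x"
  using inj_vec by (auto simp: unvec_def inj_eq)

end

section \<open>Hopf monoids in vector species\<close>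

text \<open>Set compositions are lists of blocks; the empty set has exactly the empty composition.\<close>

definition set_compositions :: "'a set \<Rightarrow> 'a set list set" where
  "set_compositions K =
     {Js. {} \<notin> set Js \<and> (\<forall>i<length Js. \<forall>j<length Js. i \<noteq> j \<longrightarrow> Js ! i \<inter> Js ! j = {}) \<and>
          \<Union> (set Js) = K}"

lemma finite_set_compositions: "finite K \<Longrightarrow> finite (set_compositions K)"
proof (rule finite_subset)
  assume "finite K"
  then show "finite {Js. set Js \<subseteq> Pow K \<and> distinct Js}"
    by (intro finite_subset_distinct) simp
  show "set_compositions K \<subseteq> {Js. set Js \<subseteq> Pow K \<and> distinct Js}"
  proof
    fix Js assume Js: "Js \<in> set_compositions K"
    have "Js ! i \<noteq> Js ! j" if "i < length Js" "j < length Js" "i \<noteq> j" for i j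
    proof
      assume "Js ! i = Js ! j"
      moreover have "Js ! i \<inter> Js ! j = {}" using Js that by (simp add: set_compositions_def)
      ultimately have "{} \<in> set Js" using that by (metis Int_absorb nth_mem)
      then show False using Js by (simp add: set_compositions_def)
    qed
    moreover have "set Js \<subseteq> Pow K" using Js by (auto simp: set_compositions_def)
    ultimately show "Js \<in> {Js. set Js \<subseteq> Pow K \<and> distinct Js}"
      by (simp add: distinct_conv_nth)
  qed
qed

text \<open>
  A species assigns spaces to the finite subsets \<open>I\<close> of the label type \<open>'a\<close>; \<open>act I \<sigma>\<close> is the
  map \<open>H I \<rightarrow> H (\<sigma> ` I)\<close> induced by a map \<open>\<sigma>\<close> that is injective on \<open>I\<close>.  For infinite \<open>'a\<close>
  these subsets and their bijections form a category equivalent to that of all finite sets.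

  The unit \<open>\<iota> : k \<rightarrow> H {}\<close> is given by its value \<open>unit_elt\<close> at 1.
\<close>

locale hopf_data = tensors scale
  for scale :: "'f::field \<Rightarrow> 'v::ab_group_add \<Rightarrow> 'v" (infixr \<open>*s\<close> 75) +
  fixes H :: "'a set \<Rightarrow> 'v set"
    and act :: "'a set \<Rightarrow> ('a \<Rightarrow> 'a) \<Rightarrow> 'v \<Rightarrow> 'v"
    and mul :: "'a set \<Rightarrow> 'a set \<Rightarrow> ('f, 'v) tensor \<Rightarrow> 'v"
    and com :: "'a set \<Rightarrow> 'a set \<Rightarrow> 'v \<Rightarrow> ('f, 'v) tensor"
    and unit_elt :: 'v
    and counit :: "'v \<Rightarrow> 'f"
begin

definition actT :: "'a set \<Rightarrow> ('a \<Rightarrow> 'a) \<Rightarrow> ('f, 'v) tensor \<Rightarrow> ('f, 'v) tensor" where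
  "actT I \<sigma> t = vec (act I \<sigma> (unvec t))"

definition mulT :: "'a set \<Rightarrow> 'a set \<Rightarrow> ('f, 'v) tensor \<Rightarrow> ('f, 'v) tensor" where
  "mulT I J t = vec (mul I J t)"

definition comT :: "'a set \<Rightarrow> 'a set \<Rightarrow> ('f, 'v) tensor \<Rightarrow> ('f, 'v) tensor" where
  "comT I J t = com I J (unvec t)"

definition counitT :: "('f, 'v) tensor \<Rightarrow> ('f, 'v) tensor" where
  "counitT t = tscale (counit (unvec t)) (pure_tensor [])"

text \<open>\<open>m\<^sub>J = m\<^bsub>J\<^sub>1 \<union> J\<^sub>2, J\<^sub>3, \<dots>\<^esub> \<circ> (m\<^bsub>J\<^sub>1, J\<^sub>2\<^esub> \<otimes> id \<otimes> \<dots> \<otimes> id)\<close> and dually for \<open>\<Delta>\<^sub>J\<close>.\<close>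

fun mul_iter :: "'a set list \<Rightarrow> ('f, 'v) tensor \<Rightarrow> 'v" where
  "mul_iter [K] = unvec"
| "mul_iter (I # J # Js) =
     mul_iter ((I \<union> J) # Js) \<circ> tensor_map [H I, H J] (map H Js) (mulT I J) id"

fun com_iter :: "'a set list \<Rightarrow> 'v \<Rightarrow> ('f, 'v) tensor" where
  "com_iter [K] = vec"
| "com_iter (I # J # Js) =
     tensor_map [H (I \<union> J)] (map H Js) (comT I J) id \<circ> com_iter ((I \<union> J) # Js)"

definition primitives :: "'a set \<Rightarrow> 'v set" where
  "primitives K = {x \<in> H K. \<forall>I J. [I, J] \<in> set_compositions K \<longrightarrow> com I J x = 0}"

definition Psi :: "'a \<Rightarrow> 'a set \<Rightarrow> 'v \<Rightarrow> 'v" where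
  "Psi k K x =
     (\<Sum>Js | Js \<in> set_compositions K \<and> k \<in> hd Js.
        ((- 1) ^ (length Js - 1)) *s mul_iter Js (com_iter Js x))"

end

locale species = hopf_data +
  assumes subspace_H: "finite I \<Longrightarrow> subspace (H I)"
    and act_linear: "finite I \<Longrightarrow> inj_on \<sigma> I \<Longrightarrow> linear_map_on scale scale (H I) (H (\<sigma> ` I)) (act I \<sigma>)"
    and act_cong: "finite I \<Longrightarrow> inj_on \<sigma> I \<Longrightarrow> (\<And>i. i \<in> I \<Longrightarrow> \<sigma> i = \<tau> i) \<Longrightarrow> x \<in> H I \<Longrightarrow>
      act I \<sigma> x = act I \<tau> x"
    and act_id: "finite I \<Longrightarrow> x \<in> H I \<Longrightarrow> act I id x = x"
    and act_comp: "finite I \<Longrightarrow> inj_on \<sigma> I \<Longrightarrow> inj_on \<tau> (\<sigma> ` I) \<Longrightarrow> x \<in> H I \<Longrightarrow>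
      act I (\<tau> \<circ> \<sigma>) x = act (\<sigma> ` I) \<tau> (act I \<sigma> x)"

locale bimonoid = species +
  assumes mul_linear: "finite I \<Longrightarrow> finite J \<Longrightarrow> I \<inter> J = {} \<Longrightarrow>
      linear_map_on tscale scale (tensor_space [H I, H J]) (H (I \<union> J)) (mul I J)"
    and com_linear: "finite I \<Longrightarrow> finite J \<Longrightarrow> I \<inter> J = {} \<Longrightarrow>
      linear_map_on scale tscale (H (I \<union> J)) (tensor_space [H I, H J]) (com I J)"
    and unit_in: "unit_elt \<in> H {}"
    and counit_linear: "linear_map_on scale (*) (H {}) UNIV counit"
    and mul_natural: "finite I \<Longrightarrow> finite J \<Longrightarrow> I \<inter> J = {} \<Longrightarrow> inj_on \<sigma> (I \<union> J) \<Longrightarrow>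
      t \<in> tensor_space [H I, H J] \<Longrightarrow>
      act (I \<union> J) \<sigma> (mul I J t) =
      mul (\<sigma> ` I) (\<sigma> ` J) (tensor_map [H I] [H J] (actT I \<sigma>) (actT J \<sigma>) t)"
    and com_natural: "finite I \<Longrightarrow> finite J \<Longrightarrow> I \<inter> J = {} \<Longrightarrow> inj_on \<sigma> (I \<union> J) \<Longrightarrow>
      x \<in> H (I \<union> J) \<Longrightarrow>
      com (\<sigma> ` I) (\<sigma> ` J) (act (I \<union> J) \<sigma> x) =
      tensor_map [H I] [H J] (actT I \<sigma>) (actT J \<sigma>) (com I J x)"
    and assoc: "finite I \<Longrightarrow> finite J \<Longrightarrow> finite K \<Longrightarrow>
      I \<inter> J = {} \<Longrightarrow> I \<inter> K = {} \<Longrightarrow> J \<inter> K = {} \<Longrightarrow> t \<in> tensor_space [H I, H J, H K] \<Longrightarrow>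
      mul (I \<union> J) K (tensor_map [H I, H J] [H K] (mulT I J) id t) =
      mul I (J \<union> K) (tensor_map [H I] [H J, H K] id (mulT J K) t)"
    and unit_left: "finite I \<Longrightarrow> x \<in> H I \<Longrightarrow> mul {} I (vec unit_elt \<otimes> vec x) = x"
    and unit_right: "finite I \<Longrightarrow> x \<in> H I \<Longrightarrow> mul I {} (vec x \<otimes> vec unit_elt) = x"
    and coassoc: "finite I \<Longrightarrow> finite J \<Longrightarrow> finite K \<Longrightarrow>
      I \<inter> J = {} \<Longrightarrow> I \<inter> K = {} \<Longrightarrow> J \<inter> K = {} \<Longrightarrow> x \<in> H (I \<union> J \<union> K) \<Longrightarrow>
      tensor_map [H (I \<union> J)] [H K] (comT I J) id (com (I \<union> J) K x) =
      tensor_map [H I] [H (J \<union> K)] id (comT J K) (com I (J \<union> K) x)"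
    and counit_left: "finite I \<Longrightarrow> x \<in> H I \<Longrightarrow>
      tensor_map [H {}] [H I] counitT id (com {} I x) = vec x"
    and counit_right: "finite I \<Longrightarrow> x \<in> H I \<Longrightarrow>
      tensor_map [H I] [H {}] id counitT (com I {} x) = vec x"
    and compat: "finite (I \<union> J) \<Longrightarrow> I \<inter> J = {} \<Longrightarrow> I' \<inter> J' = {} \<Longrightarrow> I \<union> J = I' \<union> J' \<Longrightarrow>
      A = I \<inter> I' \<Longrightarrow> B = I \<inter> J' \<Longrightarrow> C = J \<inter> I' \<Longrightarrow> D = J \<inter> J' \<Longrightarrow>
      t \<in> tensor_space [H I, H J] \<Longrightarrow>
      com I' J' (mul I J t) =
      tensor_map [H A, H C] [H B, H D] (mulT A C) (mulT B D)
        (tensor_map [H A] [H B, H C, H D] id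
            (tensor_map [H B, H C] [H D] (braiding (H B) (H C)) id)
          (tensor_map [H I] [H J] (comT A B) (comT C D) t))"
    and com_unit: "com {} {} unit_elt = vec unit_elt \<otimes> vec unit_elt"
    and counit_mul: "x \<in> H {} \<Longrightarrow> y \<in> H {} \<Longrightarrow>
      counit (mul {} {} (vec x \<otimes> vec y)) = counit x * counit y"
    and counit_unit: "counit unit_elt = 1"

text \<open>
  Hopf monoids are understood to be connected: the unit identifies \<open>k\<close> with \<open>H {}\<close>.
  A connected bimonoid has an antipode (Takeuchi's formula), so none is listed.
  Connectedness cannot be dropped: for a group \<open>G\<close>, the constant species \<open>H I = kG\<close> with
  \<open>m (g \<otimes> h) = gh\<close> and \<open>\<Delta> g = g \<otimes> g\<close> is a cocommutative bimonoid with antipode, but for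
  \<open>K = {k, j}\<close> the element \<open>\<Psi> g = g - g\<^sup>2\<close> is not primitive unless \<open>g = 1\<close>.
\<close>

locale connected_hopf_monoid = bimonoid +
  assumes connected: "H {} = span {unit_elt}"

locale cocommutative_connected_hopf_monoid = connected_hopf_monoid +
  assumes cocommutative: "finite I \<Longrightarrow> finite J \<Longrightarrow> I \<inter> J = {} \<Longrightarrow> x \<in> H (I \<union> J) \<Longrightarrow>
    com J I x = braiding (H I) (H J) (com I J x)"

end

theory Submission
  imports Defs
begin

text \<open>
  Write \<open>\<Psi>\<^sub>S\<close> for \<open>\<Psi>\<^bsub>(k,S)\<^esub>\<close>.  Splitting off the last block of each composition, and
  using connectedness for the term \<open>S = K\<close>, gives
  \<open>\<Sum>\<^bsub>k \<in> S \<subseteq> K\<^esub> m\<^bsub>S, K - S\<^esub> \<circ> (\<Psi>\<^sub>S \<otimes> id) \<circ> \<Delta>\<^bsub>S, K - S\<^esub> = id\<close>.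
  Let \<open>k \<in> A\<close>, apply \<open>\<Delta>\<^bsub>A, B\<^esub>\<close> to this identity and induct on \<open>K\<close>.  For \<open>S \<subset> K\<close> the image of
  \<open>\<Psi>\<^sub>S\<close> is primitive, so by compatibility only the terms with \<open>S \<subseteq> A\<close> survive; by
  coassociativity and the identity for \<open>A\<close> they sum to \<open>\<Delta>\<^bsub>A, B\<^esub>\<close>.  Hence the remaining term
  \<open>\<Delta>\<^bsub>A, B\<^esub> \<circ> \<Psi>\<^sub>K\<close> vanishes.  Cocommutativity settles the case \<open>k \<in> B\<close>.
\<close>

text \<open>Induction over tensors, which are functions, eta-expands \<open>0\<close> and \<open>t + u\<close>; the pointwise
  rules would then rewrite under the binder.\<close>

declare plus_fun_apply [simp del] zero_fun_apply [simp del]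

section \<open>Maps between tensor spaces\<close>

context tensors
begin

abbreviation tensor_linear ::
  "'v set list \<Rightarrow> 'v set list \<Rightarrow> (('f, 'v) tensor \<Rightarrow> ('f, 'v) tensor) \<Rightarrow> bool" where
  "tensor_linear Us Vs f \<equiv> linear_map_on tscale tscale (tensor_space Us) (tensor_space Vs) f"

section \<open>Concatenation of tensors: closure, associativity, units\<close>

lemma listset_append_iff:
  "zs \<in> listset (Us @ Vs) \<longleftrightarrow>
    (\<exists>xs ys. zs = xs @ ys \<and> xs \<in> listset Us \<and> ys \<in> listset Vs)"
proof (induction Us arbitrary: zs)
  case (Cons U Us)
  show ?case
  proof
    assume "zs \<in> listset ((U # Us) @ Vs)"
    then obtain x xs ys where "zs = x # xs @ ys" "x \<in> U" "xs \<in> listset Us" "ys \<in> listset Vs"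
      using Cons.IH by (auto simp: set_Cons_def)
    then show "\<exists>xs ys. zs = xs @ ys \<and> xs \<in> listset (U # Us) \<and> ys \<in> listset Vs"
      by (intro exI[of _ "x # xs"] exI[of _ ys]) (auto simp: set_Cons_def)
  next
    assume "\<exists>xs ys. zs = xs @ ys \<and> xs \<in> listset (U # Us) \<and> ys \<in> listset Vs"
    then show "zs \<in> listset ((U # Us) @ Vs)"
      using Cons.IH by (fastforce simp: set_Cons_def)
  qed
qed simp

lemma length_listset: "xs \<in> listset Us \<Longrightarrow> length xs = length Us"
  by (induction Us arbitrary: xs) (auto simp: set_Cons_def)

lemma pure_in_space [intro]: "xs \<in> listset Us \<Longrightarrow> pure_tensor xs \<in> tensor_space Us"
  by (simp add: tensor_space_def tensor.span_base)

lemma tensor_space_add: "t \<in> tensor_space Us \<Longrightarrow> u \<in> tensor_space Us \<Longrightarrow> t + u \<in> tensor_space Us"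
  by (simp add: tensor_space_def tensor.span_add)

lemma tensor_space_scale: "t \<in> tensor_space Us \<Longrightarrow> tscale c t \<in> tensor_space Us"
  by (simp add: tensor_space_def tensor.span_scale)

lemma tensor_space_zero: "0 \<in> tensor_space Us"
  by (simp add: tensor_space_def tensor.span_zero)

lemma tensor_times_zero_left: "0 \<otimes> u = 0"
  by (auto simp: tensor_times_def fun_eq_iff zero_fun_apply)

text \<open>In \<open>t \<otimes> u\<close> the right factor sits inside the argument of
  \<open>t\<close>, and an arbitrary functional \<open>t\<close> may be nonzero at the zero form.
  Membership of \<open>t\<close> in a tensor space makes it linear on forms; pulling the scalar 0
  out of the right factor then gives the claim.\<close>

lemma tensor_times_zero_right:
  assumes "t \<in> tensor_space Us" shows "t \<otimes> 0 = 0"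
  using tensor_times_linear(4)[OF assms tensor_space_zero, of 0] by (simp add: tscale_def fun_eq_iff zero_fun_def)

lemma tensor_times_in_space:
  assumes "t \<in> tensor_space Us" and "u \<in> tensor_space Vs"
  shows "t \<otimes> u \<in> tensor_space (Us @ Vs)"
  using assms(1)
proof (induction rule: tensor_space_induct)
  case (pure xs)
  note xs = this
  show ?case using assms(2)
  proof (induction rule: tensor_space_induct)
    case (pure ys)
    then have "xs @ ys \<in> listset (Us @ Vs)" using xs by (auto simp: listset_append_iff)
    then show ?case by (auto simp: pure_tensor_times)
  qed (use xs in \<open>auto simp: tensor_times_linear(3,4)[where Us = Us and Vs = Vs] pure_in_space
      tensor_space_add tensor_space_scale tensor_space_zero tensor_times_zero_right[OF pure_in_space]\<close>)
qed (auto simp: tensor_times_linear(1,2) tensor_space_add tensor_space_scale tensor_space_zero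
    tensor_times_zero_left)

text \<open>On pure tensors both sides concatenate three lists, so this is associativity of
  \<open>@\<close>. Three nested inductions extend it by linearity, one for each factor.\<close>

lemma tensor_times_assoc:
  assumes "t \<in> tensor_space Us" and "u \<in> tensor_space Vs" and "v \<in> tensor_space Ws"
  shows "(t \<otimes> u) \<otimes> v = t \<otimes> (u \<otimes> v)"
  using assms(1)
proof (induction rule: tensor_space_induct)
  case (pure xs)
  note xs = pure_in_space[OF this]
  show ?case using assms(2)
  proof (induction rule: tensor_space_induct)
    case (pure ys)
    note ys = pure_in_space[OF this]
    note xy = tensor_times_in_space[OF xs ys]
    show ?case using assms(3)
    proof (induction rule: tensor_space_induct)
      case (pure zs)
      then show ?case by (simp add: pure_tensor_times)
    qed (use xs ys xy in \<open>auto simp: tensor_times_linear(3,4)[OF xs tensor_times_in_space[OF ys]]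
        tensor_times_linear(3,4)[OF ys] tensor_times_linear(3,4)[OF xy]
        tensor_times_zero_right[OF xs] tensor_times_zero_right[OF ys] tensor_times_zero_right[OF xy]
        tensor_times_in_space\<close>)
  qed (use xs assms(3) in \<open>auto simp: tensor_times_linear(1,2) tensor_times_linear(3,4)[OF xs]
      tensor_times_linear(3)[OF xs tensor_times_in_space[OF _ assms(3)] tensor_times_in_space[OF _ assms(3)]]
      tensor_times_linear(4)[OF xs tensor_times_in_space[OF _ assms(3)]]
      tensor_times_zero_left tensor_times_zero_right[OF xs]\<close>)
qed (auto simp: tensor_times_linear(1,2) tensor_times_zero_left)

lemma tensor_times_pure_Nil: "t \<in> tensor_space Us \<Longrightarrow> t \<otimes> pure_tensor [] = t"
  by (induction rule: tensor_space_induct)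
    (auto simp: pure_tensor_times tensor_times_linear(1,2) tensor_times_zero_left)

section \<open>Linear maps between subsets closed under the operations\<close>

lemma linear_map_on_compose:
  "linear_map_on s s' U V f \<Longrightarrow> linear_map_on s' s'' V W g \<Longrightarrow> linear_map_on s s'' U W (g \<circ> f)"
  by (auto simp: linear_map_on_def image_subset_iff)

lemma linear_map_on_mem: "linear_map_on s s' U W f \<Longrightarrow> x \<in> U \<Longrightarrow> f x \<in> W"
  by (auto simp: linear_map_on_def)

lemma linear_map_on_add: "linear_map_on s s' U W f \<Longrightarrow> x \<in> U \<Longrightarrow> y \<in> U \<Longrightarrow> f (x + y) = f x + f y"
  by (auto simp: linear_map_on_def)

lemma linear_map_on_scale: "linear_map_on s s' U W f \<Longrightarrow> x \<in> U \<Longrightarrow> f (s c x) = s' c (f x)"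
  by (auto simp: linear_map_on_def)

lemma linear_map_on_zero: "linear_map_on s s' U W f \<Longrightarrow> 0 \<in> U \<Longrightarrow> f 0 = 0"
  using linear_map_on_add[of s s' U W f 0 0] by simp

text \<open>Closure of the domain is stated by hand rather than through \<open>subspace\<close>, so
  that the rule serves subspaces of \<open>'v\<close> and tensor spaces alike.\<close>

lemma linear_map_on_sum:
  assumes "linear_map_on s s' U W f" "0 \<in> U" "\<And>x y. x \<in> U \<Longrightarrow> y \<in> U \<Longrightarrow> x + y \<in> U"
    and "\<And>i. i \<in> I \<Longrightarrow> g i \<in> U"
  shows "f (sum g I) = (\<Sum>i\<in>I. f (g i))"
proof (cases "finite I")
  case True
  then have "sum g I \<in> U \<and> f (sum g I) = (\<Sum>i\<in>I. f (g i))"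
    using assms(4)
  proof (induction I)
    case (insert i I)
    then show ?case using assms(3) by (simp add: linear_map_on_add[OF assms(1)])
  qed (simp add: assms(2) linear_map_on_zero[OF assms(1,2)])
  then show ?thesis ..
qed (simp add: linear_map_on_zero[OF assms(1,2)])

lemma linear_map_on_id: "linear_map_on s s U U id"
  by (auto simp: linear_map_on_def)

lemma linear_map_on_cong:
  assumes "linear_map_on s s' U W f" "\<And>x. x \<in> U \<Longrightarrow> f x = g x"
    "\<And>x y. x \<in> U \<Longrightarrow> y \<in> U \<Longrightarrow> x + y \<in> U" "\<And>c x. x \<in> U \<Longrightarrow> s c x \<in> U"
  shows "linear_map_on s s' U W g"
  using assms(1,3,4) by (simp add: linear_map_on_def image_subset_iff assms(2)[symmetric])

section \<open>Functoriality of the tensor product of maps\<close>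

lemma
  assumes sub: "\<forall>U\<in>set (Us @ Vs). subspace U"
    and f: "tensor_linear Us Us' f" and g: "tensor_linear Vs Vs' g"
  shows tensor_map_linear_UNIV: "linear_map_on tscale tscale (tensor_space (Us @ Vs)) UNIV (tensor_map Us Vs f g)"
    and tensor_map_pure_append: "xs @ ys \<in> listset (Us @ Vs) \<Longrightarrow> length xs = length Us \<Longrightarrow>
      tensor_map Us Vs f g (pure_tensor (xs @ ys)) = f (pure_tensor xs) \<otimes> g (pure_tensor ys)"
  by (rule tensor_map_linear[OF _ f g] tensor_map_pure[OF _ f g]; use sub in blast)+

text \<open>The universal property describes \<open>tensor_map\<close> on pure tensors only. Both
  sides are linear in \<open>t\<close> and in \<open>u\<close>, so induction over each factor in
  turn extends the description to products of arbitrary tensors.\<close>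

lemma tensor_map_times:
  assumes sub: "\<forall>U\<in>set (Us @ Vs). subspace U"
    and f: "tensor_linear Us Us' f" and g: "tensor_linear Vs Vs' g"
    and t: "t \<in> tensor_space Us" and u: "u \<in> tensor_space Vs"
  shows "tensor_map Us Vs f g (t \<otimes> u) = f t \<otimes> g u"
proof -
  note lin = tensor_map_linear_UNIV[OF sub f g]
  note L = linear_map_on_add[OF lin] linear_map_on_scale[OF lin] linear_map_on_zero[OF lin tensor_space_zero]
  note F = linear_map_on_add[OF f] linear_map_on_scale[OF f] linear_map_on_zero[OF f tensor_space_zero]
  note G = linear_map_on_add[OF g] linear_map_on_scale[OF g] linear_map_on_zero[OF g tensor_space_zero]
  show ?thesis using t
  proof (induction rule: tensor_space_induct)
    case (pure xs)
    note xs = this pure_in_space[OF this]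
    note fx = linear_map_on_mem[OF f xs(2)]
    show ?case using u
    proof (induction rule: tensor_space_induct)
      case (pure ys)
      have "xs @ ys \<in> listset (Us @ Vs)" using xs pure by (auto simp: listset_append_iff)
      then show ?case
        by (simp add: tensor_map_pure_append[OF sub f g] pure_tensor_times length_listset[OF xs(1)])
    qed (simp_all add: tensor_times_linear(3,4)[OF xs(2)] tensor_times_linear(3)[OF fx linear_map_on_mem[OF g] linear_map_on_mem[OF g]]
        tensor_times_linear(4)[OF fx linear_map_on_mem[OF g]]
        tensor_times_zero_right[OF xs(2)] tensor_times_zero_right[OF fx] L G
        tensor_times_in_space[OF xs(2)])
  qed (simp_all add: tensor_times_linear(1,2) tensor_times_zero_left L F tensor_times_in_space[OF _ u])
qed

text \<open>A pure tensor over \<open>Us @ Vs\<close> cuts at the border into a product of two pure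
  tensors, so products \<open>t \<otimes> u\<close> can replace pure tensors as generators.\<close>

lemma tensor_space_append_induct [consumes 1, case_names zero add scale times]:
  assumes "t \<in> tensor_space (Us @ Vs)" and "P 0"
    and "\<And>t u. t \<in> tensor_space (Us @ Vs) \<Longrightarrow> u \<in> tensor_space (Us @ Vs) \<Longrightarrow> P t \<Longrightarrow> P u \<Longrightarrow> P (t + u)"
    and "\<And>c t. t \<in> tensor_space (Us @ Vs) \<Longrightarrow> P t \<Longrightarrow> P (tscale c t)"
    and times: "\<And>t u. t \<in> tensor_space Us \<Longrightarrow> u \<in> tensor_space Vs \<Longrightarrow> P (t \<otimes> u)"
  shows "P t"
  using assms(1)
proof (induction rule: tensor_space_induct)
  case (pure zs)
  then obtain xs ys where "zs = xs @ ys" "xs \<in> listset Us" "ys \<in> listset Vs"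
    by (auto simp: listset_append_iff)
  then show ?case using times[OF pure_in_space pure_in_space] by (simp add: pure_tensor_times)
qed (use assms in auto)

lemma tensor_append_ext:
  assumes h: "linear_map_on tscale s (tensor_space (Us @ Vs)) W h"
    and h': "linear_map_on tscale s (tensor_space (Us @ Vs)) W' h'"
    and eq: "\<And>t u. t \<in> tensor_space Us \<Longrightarrow> u \<in> tensor_space Vs \<Longrightarrow> h (t \<otimes> u) = h' (t \<otimes> u)"
    and t: "t \<in> tensor_space (Us @ Vs)"
  shows "h t = h' t"
  using t
  by (induction rule: tensor_space_append_induct)
    (simp_all add: eq linear_map_on_add[OF h] linear_map_on_scale[OF h] linear_map_on_zero[OF h tensor_space_zero]
     linear_map_on_add[OF h'] linear_map_on_scale[OF h'] linear_map_on_zero[OF h' tensor_space_zero])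

lemma tensor_map_tensor_linear:
  assumes sub: "\<forall>U\<in>set (Us @ Vs). subspace U"
    and f: "tensor_linear Us Us' f" and g: "tensor_linear Vs Vs' g"
  shows "tensor_linear (Us @ Vs) (Us' @ Vs') (tensor_map Us Vs f g)"
proof -
  note lin = tensor_map_linear_UNIV[OF sub f g]
  have "tensor_map Us Vs f g t \<in> tensor_space (Us' @ Vs')" if "t \<in> tensor_space (Us @ Vs)" for t
    using that
    by (induction rule: tensor_space_append_induct)
      (simp_all add: linear_map_on_add[OF lin] linear_map_on_scale[OF lin] linear_map_on_zero[OF lin tensor_space_zero]
        tensor_space_zero tensor_space_add tensor_space_scale tensor_map_times[OF sub f g]
        tensor_times_in_space linear_map_on_mem[OF f] linear_map_on_mem[OF g])
  then show ?thesis using lin by (auto simp: linear_map_on_def)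
qed

text \<open>The uniqueness half of the universal property. It reduces an identity between composites
  of \<open>tensor_map\<close> to a check on products \<open>t \<otimes> u\<close>.\<close>

lemma tensor_map_unique:
  assumes sub: "\<forall>U\<in>set (Us @ Vs). subspace U"
    and f: "tensor_linear Us Us' f" and g: "tensor_linear Vs Vs' g"
    and h: "linear_map_on tscale tscale (tensor_space (Us @ Vs)) W h"
    and eq: "\<And>t u. t \<in> tensor_space Us \<Longrightarrow> u \<in> tensor_space Vs \<Longrightarrow> h (t \<otimes> u) = f t \<otimes> g u"
    and t: "t \<in> tensor_space (Us @ Vs)"
  shows "tensor_map Us Vs f g t = h t"
  by (rule tensor_append_ext[OF tensor_map_tensor_linear[OF sub f g] h _ t])
    (simp_all add: tensor_map_times[OF sub f g] eq)

lemma tensor_map_compose: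
  assumes sub: "\<forall>U\<in>set (Us @ Vs). subspace U"
    and sub': "\<forall>U\<in>set (Us' @ Vs'). subspace U"
    and f: "tensor_linear Us Us' f" and g: "tensor_linear Vs Vs' g"
    and f': "tensor_linear Us' Us'' f'" and g': "tensor_linear Vs' Vs'' g'"
    and t: "t \<in> tensor_space (Us @ Vs)"
  shows "tensor_map Us' Vs' f' g' (tensor_map Us Vs f g t) = tensor_map Us Vs (f' \<circ> f) (g' \<circ> g) t"
proof -
  note C = linear_map_on_compose[OF f f'] linear_map_on_compose[OF g g']
  note D = linear_map_on_compose[OF tensor_map_tensor_linear[OF sub f g] tensor_map_tensor_linear[OF sub' f' g']]
  have "tensor_map Us Vs (f' \<circ> f) (g' \<circ> g) t = (tensor_map Us' Vs' f' g' \<circ> tensor_map Us Vs f g) t"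
    by (rule tensor_map_unique[OF sub C D _ t])
      (simp add: tensor_map_times[OF sub f g] tensor_map_times[OF sub' f' g']
        linear_map_on_mem[OF f] linear_map_on_mem[OF g])
  then show ?thesis by simp
qed

text \<open>Uniqueness leaves products \<open>t \<otimes> u\<close> with \<open>u\<close> over
  \<open>Vs @ Ws\<close>. A second induction cuts \<open>u\<close> in two, and there both sides are
  the product of the three images.\<close>

lemma tensor_map_assoc:
  assumes sub: "\<forall>U\<in>set (Us @ Vs @ Ws). subspace U"
    and f: "tensor_linear Us Us' f" and g: "tensor_linear Vs Vs' g" and h: "tensor_linear Ws Ws' h"
    and t: "t \<in> tensor_space (Us @ Vs @ Ws)"
  shows "tensor_map Us (Vs @ Ws) f (tensor_map Vs Ws g h) t = tensor_map (Us @ Vs) Ws (tensor_map Us Vs f g) h t"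
proof -
  have s1: "\<forall>U\<in>set (Vs @ Ws). subspace U" and s2: "\<forall>U\<in>set (Us @ Vs). subspace U"
    and s3: "\<forall>U\<in>set ((Us @ Vs) @ Ws). subspace U"
    using sub by auto
  note gh = tensor_map_tensor_linear[OF s1 g h]
  note fg = tensor_map_tensor_linear[OF s2 f g]
  \<comment> \<open>Both groupings of the list of factors give literally the same tensor space,
    because \<open>@\<close> is associative.\<close>
  note R = tensor_map_tensor_linear[OF s3 fg h, simplified append_assoc]
  show ?thesis
  proof (rule tensor_map_unique[OF sub f gh R _ t])
    fix t u assume t: "t \<in> tensor_space Us" and u: "u \<in> tensor_space (Vs @ Ws)"
    note L = tensor_map_tensor_linear[OF s1 g h]
    from u show "tensor_map (Us @ Vs) Ws (tensor_map Us Vs f g) h (t \<otimes> u) = f t \<otimes> tensor_map Vs Ws g h u"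
    proof (induction rule: tensor_space_append_induct)
      case (times u v)
      then show ?case
        using t tensor_map_times[OF s3 fg h tensor_times_in_space[OF t times(1)] times(2)]
        by (simp add: tensor_times_assoc[OF t times, symmetric] tensor_map_times[OF s2 f g] tensor_map_times[OF s1 g h]
          tensor_times_assoc[OF linear_map_on_mem[OF f t] linear_map_on_mem[OF g] linear_map_on_mem[OF h]])
    next
      case (add u v)
      then show ?case
        using tensor_times_in_space[OF t]
        by (simp add: tensor_times_linear(3)[OF t] linear_map_on_add[OF R] linear_map_on_add[OF L]
          tensor_times_linear(3)[OF linear_map_on_mem[OF f t] linear_map_on_mem[OF L] linear_map_on_mem[OF L]])
    next
      case (scale c u)
      then show ?case
        using tensor_times_in_space[OF t]
        by (simp add: tensor_times_linear(4)[OF t] linear_map_on_scale[OF R] linear_map_on_scale[OF L]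
          tensor_times_linear(4)[OF linear_map_on_mem[OF f t] linear_map_on_mem[OF L]])
    next
      case zero
      show ?case
        by (simp add: tensor_times_zero_right[OF t] tensor_times_zero_right[OF linear_map_on_mem[OF f t]]
          linear_map_on_zero[OF R tensor_space_zero] linear_map_on_zero[OF L tensor_space_zero])
    qed
  qed
qed

lemma tensor_map_id:
  assumes sub: "\<forall>U\<in>set (Us @ Vs). subspace U" and t: "t \<in> tensor_space (Us @ Vs)"
  shows "tensor_map Us Vs id id t = t"
  using tensor_map_unique[OF sub linear_map_on_id linear_map_on_id linear_map_on_id _ t] by simp

text \<open>Maps that agree only on the tensor spaces may differ elsewhere, and the choice in
  \<open>tensor_induced\<close> may then return different functions; the results are compared only
  on \<open>tensor_space (Us @ Vs)\<close>, where uniqueness applies.\<close>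

lemma tensor_map_cong:
  assumes sub: "\<forall>U\<in>set (Us @ Vs). subspace U"
    and f: "tensor_linear Us Us' f" and g: "tensor_linear Vs Vs' g"
    and f': "\<And>t. t \<in> tensor_space Us \<Longrightarrow> f t = f' t" and g': "\<And>t. t \<in> tensor_space Vs \<Longrightarrow> g t = g' t"
    and t: "t \<in> tensor_space (Us @ Vs)"
  shows "tensor_map Us Vs f g t = tensor_map Us Vs f' g' t"
proof -
  have F: "tensor_linear Us Us' f'" by (rule linear_map_on_cong[OF f f' tensor_space_add tensor_space_scale])
  have G: "tensor_linear Vs Vs' g'" by (rule linear_map_on_cong[OF g g' tensor_space_add tensor_space_scale])
  show ?thesis
    by (rule tensor_map_unique[OF sub f g tensor_map_tensor_linear[OF sub F G] _ t])
      (simp_all add: tensor_map_times[OF sub F G] f' g')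
qed

text \<open>The empty tensor product is the ground field, spanned by \<open>pure_tensor []\<close>,
  which is a right unit for \<open>\<otimes>\<close>. The lemma removes the empty tail left by the
  iterated operations on two blocks.\<close>

lemma tensor_map_Nil:
  assumes sub: "\<forall>U\<in>set Us. subspace U" and f: "tensor_linear Us Us' f" and t: "t \<in> tensor_space Us"
  shows "tensor_map Us [] f id t = f t"
proof -
  have s: "\<forall>U\<in>set (Us @ []). subspace U" using sub by simp
  have "pure_tensor [] \<in> tensor_space []" by auto
  from tensor_map_times[OF s f linear_map_on_id t this] show ?thesis
    by (simp add: tensor_times_pure_Nil[OF t] tensor_times_pure_Nil[OF linear_map_on_mem[OF f t]])
qed

text \<open>The identity on \<open>Vs @ Ws\<close> is \<open>id \<otimes> id\<close>, after which
  \<open>tensor_map_assoc\<close> moves \<open>Vs\<close> to the left group.\<close>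

lemma tensor_map_id_right:
  assumes sub: "\<forall>U\<in>set (Us @ Vs @ Ws). subspace U" and f: "tensor_linear Us Us' f"
    and t: "t \<in> tensor_space (Us @ Vs @ Ws)"
  shows "tensor_map Us (Vs @ Ws) f id t = tensor_map (Us @ Vs) Ws (tensor_map Us Vs f id) id t"
proof -
  have sub': "\<forall>U\<in>set (Vs @ Ws). subspace U" using sub by auto
  have "tensor_map Us (Vs @ Ws) f id t = tensor_map Us (Vs @ Ws) f (tensor_map Vs Ws id id) t"
    by (rule tensor_map_cong[OF sub f linear_map_on_id _ _ t]) (simp_all add: tensor_map_id[OF sub'])
  then show ?thesis using tensor_map_assoc[OF sub f linear_map_on_id linear_map_on_id t] by simp
qed

lemma tensor_times_sum_left:
  "(\<Sum>i\<in>I. f i) \<otimes> u = (\<Sum>i\<in>I. f i \<otimes> u)"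
  by (induction I rule: infinite_finite_induct) (simp_all add: tensor_times_zero_left tensor_times_linear(1))

lemma linear_map_on_sum_fun:
  assumes "vector_space s'" and f: "\<And>i. i \<in> I \<Longrightarrow> linear_map_on s s' U W (f i)"
    and W: "0 \<in> W" "\<And>x y. x \<in> W \<Longrightarrow> y \<in> W \<Longrightarrow> x + y \<in> W"
  shows "linear_map_on s s' U W (\<lambda>x. \<Sum>i\<in>I. f i x)"
proof -
  interpret vs: vector_space s' by fact
  \<comment> \<open>Stated for subsets of \<open>I\<close>, so that the assumption on
    \<open>f\<close> survives the induction.\<close>
  have "(\<Sum>i\<in>J. f i x) \<in> W" if "J \<subseteq> I" "x \<in> U" for J x
    using that
  proof (induction J rule: infinite_finite_induct)
    case (insert j J)
    then show ?case using W linear_map_on_mem[OF f[of j] insert(5)] by simp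
  qed (use W in auto)
  moreover have "(\<Sum>i\<in>I. f i (x + y)) = (\<Sum>i\<in>I. f i x) + (\<Sum>i\<in>I. f i y)" if "x \<in> U" "y \<in> U" for x y
    unfolding sum.distrib[symmetric]
    by (rule sum.cong[OF refl linear_map_on_add[OF f that]])
  moreover have "(\<Sum>i\<in>I. f i (s c x)) = s' c (\<Sum>i\<in>I. f i x)" if "x \<in> U" for c x
    unfolding vs.scale_sum_right
    by (rule sum.cong[OF refl linear_map_on_scale[OF f that]])
  ultimately show ?thesis by (auto simp: linear_map_on_def)
qed

lemma linear_map_on_scale_fun:
  assumes "vector_space s'" and f: "linear_map_on s s' U W f"
    and W: "\<And>c x. x \<in> W \<Longrightarrow> s' c x \<in> W"
  shows "linear_map_on s s' U W (\<lambda>x. s' c (f x))"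
proof -
  interpret vs: vector_space s' by fact
  show ?thesis using f W by (auto simp: linear_map_on_def vs.scale_right_distrib)
qed

lemma tensor_map_sum_left:
  assumes sub: "\<forall>U\<in>set (Us @ Vs). subspace U"
    and f: "\<And>i. i \<in> I \<Longrightarrow> tensor_linear Us Us' (f i)" and g: "tensor_linear Vs Vs' g"
    and t: "t \<in> tensor_space (Us @ Vs)"
  shows "tensor_map Us Vs (\<lambda>t. \<Sum>i\<in>I. f i t) g t = (\<Sum>i\<in>I. tensor_map Us Vs (f i) g t)"
proof (rule tensor_map_unique[OF sub _ g _ _ t])
  show "tensor_linear Us Us' (\<lambda>t. \<Sum>i\<in>I. f i t)"
    by (rule linear_map_on_sum_fun[OF tensor.vector_space_axioms f tensor_space_zero tensor_space_add])
  show "tensor_linear (Us @ Vs) (Us' @ Vs') (\<lambda>t. \<Sum>i\<in>I. tensor_map Us Vs (f i) g t)"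
    by (rule linear_map_on_sum_fun[OF tensor.vector_space_axioms _ tensor_space_zero tensor_space_add])
      (rule tensor_map_tensor_linear[OF sub f g])
  show "(\<Sum>i\<in>I. tensor_map Us Vs (f i) g (t \<otimes> u)) = (\<Sum>i\<in>I. f i t) \<otimes> g u"
    if "t \<in> tensor_space Us" "u \<in> tensor_space Vs" for t u
    unfolding tensor_times_sum_left
    by (rule sum.cong[OF refl tensor_map_times[OF sub f g that]])
qed

lemma tensor_map_scale_left:
  assumes sub: "\<forall>U\<in>set (Us @ Vs). subspace U"
    and f: "tensor_linear Us Us' f" and g: "tensor_linear Vs Vs' g"
    and t: "t \<in> tensor_space (Us @ Vs)"
  shows "tensor_map Us Vs (\<lambda>t. tscale c (f t)) g t = tscale c (tensor_map Us Vs f g t)"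
proof (rule tensor_map_unique[OF sub _ g _ _ t])
  show "tensor_linear Us Us' (\<lambda>t. tscale c (f t))"
    by (rule linear_map_on_scale_fun[OF tensor.vector_space_axioms f tensor_space_scale])
  show "tensor_linear (Us @ Vs) (Us' @ Vs') (\<lambda>t. tscale c (tensor_map Us Vs f g t))"
    by (rule linear_map_on_scale_fun[OF tensor.vector_space_axioms tensor_map_tensor_linear[OF sub f g] tensor_space_scale])
  show "tscale c (tensor_map Us Vs f g (t \<otimes> u)) = tscale c (f t) \<otimes> g u"
    if "t \<in> tensor_space Us" "u \<in> tensor_space Vs" for t u
    by (simp add: tensor_map_times[OF sub f g that] tensor_times_linear(2))
qed

section \<open>One-fold tensors and the braiding\<close>

lemma pure_tensor_add: "pure_tensor (us @ (x + y) # vs) = pure_tensor (us @ x # vs) + pure_tensor (us @ y # vs)"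
  and pure_tensor_scale: "pure_tensor (us @ (c *s x) # vs) = tscale c (pure_tensor (us @ x # vs))"
  by (auto simp: pure_tensor_def multilinear_form_def tscale_def fun_eq_iff plus_fun_apply Vector_Spaces.linear_iff)

lemma vec_add: "vec (x + y) = vec x + vec y" and vec_scale: "vec (c *s x) = tscale c (vec x)"
  using pure_tensor_add[of "[]" x y "[]"] pure_tensor_scale[of "[]" c x "[]"] by (simp_all add: vec_def)

lemma vec_linear: "linear_map_on scale tscale U (tensor_space [U]) vec"
  by (auto simp: linear_map_on_def vec_add vec_scale) (auto simp: vec_def set_Cons_def)

text \<open>Pure tensors of length one are already closed under linear combinations, because
  \<open>vec\<close> is linear.\<close>

lemma tensor_space_singleton:
  assumes "subspace U" shows "tensor_space [U] = vec ` U"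
proof
  show "tensor_space [U] \<subseteq> vec ` U"
  proof
    fix t assume "t \<in> tensor_space [U]"
    then show "t \<in> vec ` U"
    proof (induction rule: tensor_space_induct)
      case zero
      show ?case using linear_map_on_zero[OF vec_linear, of U] assms
        by (metis imageI subspace_0)
    next
      case (add t u)
      then show ?case using assms by (auto simp: vec_add[symmetric] subspace_add)
    next
      case (scale c t)
      then show ?case using assms by (auto simp: vec_scale[symmetric] subspace_scale)
    qed (auto simp: vec_def set_Cons_def)
  qed
qed (use vec_linear linear_map_on_mem in blast)

lemma unvec_linear:
  assumes "subspace U" shows "linear_map_on tscale scale (tensor_space [U]) U unvec"
  by (auto simp: linear_map_on_def tensor_space_singleton[OF assms] vec_add[symmetric] vec_scale[symmetric])

lemma vec_unvec: "subspace U \<Longrightarrow> t \<in> tensor_space [U] \<Longrightarrow> vec (unvec t) = t"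
  by (auto simp: tensor_space_singleton)

lemma vec_in_space: "x \<in> U \<Longrightarrow> vec x \<in> tensor_space [U]"
  using vec_linear linear_map_on_mem by blast

lemma braiding_linear:
  assumes "subspace U" "subspace V"
  shows "linear_map_on tscale tscale (tensor_space [U, V]) (tensor_space [V, U]) (braiding U V)"
    and "x \<in> U \<Longrightarrow> y \<in> V \<Longrightarrow> braiding U V (vec x \<otimes> vec y) = vec y \<otimes> vec x"
proof -
  \<comment> \<open>Reversal turns \<open>xs @ x # ys\<close> into
    \<open>rev ys @ x # rev xs\<close>, so each entry still occupies one slot of a pure
    tensor.\<close>
  have ml: "multilinear_on tscale [U, V] (\<lambda>zs. pure_tensor (rev zs))"
    unfolding multilinear_on_def
  proof (intro allI impI)
    fix A W B and xs ys :: "'v list"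
    show "linear_map_on scale tscale W UNIV (\<lambda>x. pure_tensor (rev (xs @ x # ys)))"
      by (simp add: linear_map_on_def pure_tensor_add pure_tensor_scale)
  qed
  have sub: "\<And>W. W \<in> set [U, V] \<Longrightarrow> subspace W" using assms by auto
  have lin: "linear_map_on tscale tscale (tensor_space [U, V]) UNIV (braiding U V)"
    and pr: "\<And>xs. xs \<in> listset [U, V] \<Longrightarrow> braiding U V (pure_tensor xs) = pure_tensor (rev xs)"
    unfolding braiding_def
    by (rule tensor_induced_linear[OF tensor.vector_space_axioms _ ml]
        tensor_induced_pure[OF tensor.vector_space_axioms _ ml]; use sub in simp)+
  have "braiding U V t \<in> tensor_space [V, U]" if "t \<in> tensor_space [U, V]" for t
    using that
  proof (induction rule: tensor_space_induct)
    case (pure xs)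
    then have "rev xs \<in> listset [V, U]" by (auto simp: set_Cons_def)
    then show ?case using pr[of xs] pure by auto
  qed (simp_all add: linear_map_on_add[OF lin] linear_map_on_scale[OF lin] linear_map_on_zero[OF lin tensor_space_zero]
        tensor_space_zero tensor_space_add tensor_space_scale)
  then show "linear_map_on tscale tscale (tensor_space [U, V]) (tensor_space [V, U]) (braiding U V)"
    using lin by (auto simp: linear_map_on_def)
  show "x \<in> U \<Longrightarrow> y \<in> V \<Longrightarrow> braiding U V (vec x \<otimes> vec y) = vec y \<otimes> vec x"
    using pr[of "[x, y]"] by (simp add: vec_def pure_tensor_times set_Cons_def)
qed

end

section \<open>Splitting off the last block\<close>

lemma set_compositions_snoc:
  "Js @ [T] \<in> set_compositions K \<longleftrightarrow> T \<noteq> {} \<and> T \<subseteq> K \<and> Js \<in> set_compositions (K - T)"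
proof -
  have "(\<forall>i<length (Js @ [T]). \<forall>j<length (Js @ [T]). i \<noteq> j \<longrightarrow> (Js @ [T]) ! i \<inter> (Js @ [T]) ! j = {}) \<longleftrightarrow>
    (\<forall>i<length Js. \<forall>j<length Js. i \<noteq> j \<longrightarrow> Js ! i \<inter> Js ! j = {}) \<and> (\<forall>i<length Js. Js ! i \<inter> T = {})"
    by (auto simp: All_less_Suc nth_append Int_commute) blast
  \<comment> \<open>Disjointness from \<open>T\<close> is what turns the union of the other blocks
    into \<open>K - T\<close>.\<close>
  moreover have "(\<forall>i<length Js. Js ! i \<inter> T = {}) \<longleftrightarrow> \<Union> (set Js) \<inter> T = {}"
    unfolding all_set_conv_all_nth[of Js "\<lambda>J. J \<inter> T = {}", symmetric] by auto
  ultimately show ?thesis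
    unfolding set_compositions_def mem_Collect_eq by auto
qed

lemma set_compositions_Cons:
  "I # Js \<in> set_compositions K \<longleftrightarrow> I \<noteq> {} \<and> I \<subseteq> K \<and> Js \<in> set_compositions (K - I)"
proof -
  have "(\<forall>i<length (I # Js). \<forall>j<length (I # Js). i \<noteq> j \<longrightarrow> (I # Js) ! i \<inter> (I # Js) ! j = {}) \<longleftrightarrow>
    (\<forall>i<length Js. \<forall>j<length Js. i \<noteq> j \<longrightarrow> Js ! i \<inter> Js ! j = {}) \<and> (\<forall>i<length Js. Js ! i \<inter> I = {})"
    by (auto simp: All_less_Suc2 Int_commute) blast
  moreover have "(\<forall>i<length Js. Js ! i \<inter> I = {}) \<longleftrightarrow> \<Union> (set Js) \<inter> I = {}"
    unfolding all_set_conv_all_nth[of Js "\<lambda>J. J \<inter> I = {}", symmetric] by auto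
  ultimately show ?thesis
    unfolding set_compositions_def mem_Collect_eq by auto
qed

lemma set_compositions_Nil: "[] \<in> set_compositions K \<longleftrightarrow> K = {}"
  by (auto simp: set_compositions_def)

text \<open>Supports induction along \<open>mul_iter\<close> and \<open>com_iter\<close>, whose
  recursion merges the first two blocks.\<close>

lemma set_compositions_merge:
  "I # J # Js \<in> set_compositions K \<Longrightarrow> (I \<union> J) # Js \<in> set_compositions K"
  by (auto simp: set_compositions_Cons Diff_Un Diff_Diff_Int set_diff_eq)

lemma set_compositions_finite: "Js \<in> set_compositions K \<Longrightarrow> finite K \<Longrightarrow> J \<in> set Js \<Longrightarrow> finite J"
  by (auto simp: set_compositions_def intro: finite_subset)

text \<open>Removing the last block leaves either nothing, and the composition was
  \<open>[K]\<close>, or a composition of a proper subset \<open>S\<close> with the same first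
  block, so that \<open>k\<close> still lies in it.\<close>

lemma set_compositions_hd_split:
  assumes "k \<in> K"
  shows "{Js \<in> set_compositions K. k \<in> hd Js} =
    insert [K] ((\<lambda>(S, Js). Js @ [K - S]) `
      (SIGMA S:{S. k \<in> S \<and> S \<subset> K}. {Js \<in> set_compositions S. k \<in> hd Js}))"
    (is "?L = insert [K] (?f ` ?R)")
proof (intro equalityI subsetI)
  fix Js assume Js: "Js \<in> ?L"
  then have "Js \<noteq> []" using assms by (auto simp: set_compositions_Nil)
  then obtain Ls T where eq: "Js = Ls @ [T]" by (metis rev_exhaust)
  then have T: "T \<noteq> {}" "T \<subseteq> K" "Ls \<in> set_compositions (K - T)" using Js by (simp_all add: set_compositions_snoc)
  show "Js \<in> insert [K] (?f ` ?R)"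
  proof (cases Ls)
    case Nil
    then show ?thesis using T eq by (auto simp: set_compositions_Nil)
  next
    case (Cons L Ls')
    then have "k \<in> L" "L \<subseteq> K - T" using Js T eq by (auto simp: set_compositions_Cons)
    then have "(K - T, Ls) \<in> ?R" "Js = ?f (K - T, Ls)"
      using T eq Cons by auto
    then show ?thesis by blast
  qed
next
  fix Js assume "Js \<in> insert [K] (?f ` ?R)"
  then show "Js \<in> ?L"
  proof
    assume "Js = [K]"
    then show ?thesis using assms by (auto simp: set_compositions_Cons set_compositions_Nil)
  next
    assume "Js \<in> ?f ` ?R"
    then obtain S Ls where S: "k \<in> S" "S \<subset> K" "Ls \<in> set_compositions S" "k \<in> hd Ls" "Js = Ls @ [K - S]"
      by auto
    then have "Ls \<noteq> []" by (auto simp: set_compositions_Nil)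
    moreover have "K - (K - S) = S" using S by auto
    ultimately show ?thesis using S by (auto simp: set_compositions_snoc)
  qed
qed

section \<open>Iterated products and coproducts\<close>

context hopf_data
begin

text \<open>The form in which \<open>Psi\<close> can enter \<open>tensor_map\<close>, whose
  arguments act on tensors rather than on vectors.\<close>

abbreviation PsiT :: "'a \<Rightarrow> 'a set \<Rightarrow> ('f, 'v) tensor \<Rightarrow> ('f, 'v) tensor" where
  "PsiT k S \<equiv> vec \<circ> Psi k S \<circ> unvec"

text \<open>The \<open>(S, T)\<close> component of the convolution product of \<open>Psi k\<close>
  with the identity.\<close>

abbreviation Psi_conv :: "'a \<Rightarrow> 'a set \<Rightarrow> 'a set \<Rightarrow> 'v \<Rightarrow> 'v" where
  "Psi_conv k S T x \<equiv> mul S T (tensor_map [H S] [H T] (PsiT k S) id (com S T x))"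

end

context bimonoid
begin

lemma mulT_linear:
  "finite I \<Longrightarrow> finite J \<Longrightarrow> I \<inter> J = {} \<Longrightarrow> tensor_linear [H I, H J] [H (I \<union> J)] (mulT I J)"
  using linear_map_on_compose[OF mul_linear vec_linear, of I J] by (simp add: mulT_def[abs_def] o_def)

lemma comT_linear:
  "finite I \<Longrightarrow> finite J \<Longrightarrow> I \<inter> J = {} \<Longrightarrow> tensor_linear [H (I \<union> J)] [H I, H J] (comT I J)"
  using linear_map_on_compose[OF unvec_linear com_linear, of I J] subspace_H by (simp add: comT_def[abs_def] o_def)

lemma subspaces_composition:
  "Js \<in> set_compositions K \<Longrightarrow> finite K \<Longrightarrow> \<forall>U\<in>set (map H Js). subspace U"
  using subspace_H set_compositions_finite by auto

lemma mul_iter_linear: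
  assumes "Js \<in> set_compositions K" "finite K" "Js \<noteq> []"
  shows "linear_map_on tscale scale (tensor_space (map H Js)) (H K) (mul_iter Js)"
  using assms
\<comment> \<open>\<open>mul_iter\<close> and \<open>com_iter\<close> recurse on the list in the
  same way, so one rule serves both. Its remaining case, the empty list, is excluded by
  assumption.\<close>
proof (induction Js rule: com_iter.induct)
  case (1 L)
  then show ?case using unvec_linear[OF subspace_H] by (auto simp: set_compositions_Cons set_compositions_Nil)
next
  case (2 I J Js)
  have fin: "finite I" "finite J" "I \<inter> J = {}"
    using 2 by (auto simp: set_compositions_Cons intro: finite_subset)
  note sub = subspaces_composition[OF 2(2,3)]
  have mul_merge: "linear_map_on tscale scale (tensor_space (map H ((I \<union> J) # Js))) (H K) (mul_iter ((I \<union> J) # Js))"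
    using 2(1)[OF set_compositions_merge[OF 2(2)] 2(3)] by simp
  have "tensor_linear ([H I, H J] @ map H Js) ([H (I \<union> J)] @ map H Js)
      (tensor_map [H I, H J] (map H Js) (mulT I J) id)"
    by (rule tensor_map_tensor_linear[OF _ mulT_linear linear_map_on_id]) (use fin sub in auto)
  then show ?case
    using linear_map_on_compose[OF _ mul_merge] by (simp add: comp_def)
qed simp

lemma com_iter_linear:
  assumes "Js \<in> set_compositions K" "finite K" "Js \<noteq> []"
  shows "linear_map_on scale tscale (H K) (tensor_space (map H Js)) (com_iter Js)"
  using assms
proof (induction Js rule: com_iter.induct)
  case (1 L)
  then show ?case using vec_linear by (auto simp: set_compositions_Cons set_compositions_Nil)
next
  case (2 I J Js)
  have fin: "finite I" "finite J" "I \<inter> J = {}"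
    using 2 by (auto simp: set_compositions_Cons intro: finite_subset)
  note sub = subspaces_composition[OF set_compositions_merge[OF 2(2)] 2(3)]
  have com_merge: "linear_map_on scale tscale (H K) (tensor_space (map H ((I \<union> J) # Js))) (com_iter ((I \<union> J) # Js))"
    using 2(1)[OF set_compositions_merge[OF 2(2)] 2(3)] by simp
  have "tensor_linear ([H (I \<union> J)] @ map H Js) ([H I, H J] @ map H Js)
      (tensor_map [H (I \<union> J)] (map H Js) (comT I J) id)"
    by (rule tensor_map_tensor_linear[OF _ comT_linear linear_map_on_id]) (use fin sub in auto)
  then show ?case
    using linear_map_on_compose[OF com_merge] by (simp del: comp_apply)
qed simp

text \<open>The recursion consumes blocks from the front, whereas the recursion for
  \<open>Psi\<close> removes the last one. Merging the first two blocks leaves \<open>T\<close> in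
  last place, so the induction hypothesis applies, and functoriality collects everything that acts
  before \<open>T\<close> into one map.\<close>

lemma mul_iter_snoc:
  assumes "Js @ [T] \<in> set_compositions K" "finite K" "Js \<noteq> []"
    and "t \<in> tensor_space (map H (Js @ [T]))"
  shows "mul_iter (Js @ [T]) t = mul (K - T) T (tensor_map (map H Js) [H T] (vec \<circ> mul_iter Js) id t)"
  using assms
proof (induction Js arbitrary: t rule: com_iter.induct)
  case (1 L)
  then have L: "L = K - T" "finite T" "finite (K - T)" and "T \<subseteq> K"
    by (auto simp: set_compositions_Cons set_compositions_Nil intro: finite_subset)
  have t: "t \<in> tensor_space [H (K - T), H T]" using 1(4) by (simp add: L)
  have sub: "\<forall>U\<in>set [H (K - T), H T]. subspace U" using L subspace_H by simp
  \<comment> \<open>For a single block before \<open>T\<close>, \<open>mul_iter\<close> is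
    \<open>unvec\<close>, and \<open>vec \<circ> unvec\<close> is the identity on one-fold
    tensors.\<close>
  have "tensor_map [H (K - T)] [H T] (vec \<circ> unvec) id t = tensor_map [H (K - T)] [H T] id id t"
    by (rule tensor_map_cong[where Us' = "[H (K - T)]" and Vs' = "[H T]"])
      (use sub t in \<open>simp_all add: vec_unvec[where U = "H (K - T)"] linear_map_on_id linear_map_on_compose[OF unvec_linear vec_linear]\<close>)
  also have "\<dots> = t" by (rule tensor_map_id) (use sub t in simp_all)
  finally show ?case
    using tensor_map_Nil[OF sub mulT_linear t] L by (simp add: mulT_def comp_def id_def Int_commute)
next
  case (2 I J Js)
  have comp: "I # J # Js \<in> set_compositions (K - T)" "finite (K - T)"
    using 2(2,3) set_compositions_snoc[of "I # J # Js"] by simp_all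
  have fin: "finite I" "finite J" "I \<inter> J = {}"
    using 2 by (auto simp: set_compositions_Cons intro: finite_subset)
  note sub = subspaces_composition[OF 2(2,3)]
  note sub' = subspaces_composition[OF set_compositions_merge[OF 2(2)[simplified]] 2(3)]
  note sub'' = subspaces_composition[OF comp]
  note m = mulT_linear[OF fin]
  have t: "t \<in> tensor_space ([H I, H J] @ map H Js @ [H T])" using 2(5) by simp
  have lin: "tensor_linear ([H I, H J] @ map H Js) ([H (I \<union> J)] @ map H Js)
      (tensor_map [H I, H J] (map H Js) (mulT I J) id)"
    by (rule tensor_map_tensor_linear[OF _ m linear_map_on_id]) (use sub'' in auto)
  \<comment> \<open>Regrouping isolates the factor of \<open>T\<close>, which makes this map
    composable with the one from the induction hypothesis.\<close>
  have eq: "tensor_map [H I, H J] (map H Js @ [H T]) (mulT I J) id t =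
    tensor_map ([H I, H J] @ map H Js) [H T] (tensor_map [H I, H J] (map H Js) (mulT I J) id) id t"
    by (rule tensor_map_id_right[OF _ m t]) (use sub in auto)
  have "tensor_map [H I, H J] (map H Js @ [H T]) (mulT I J) id t \<in> tensor_space ([H (I \<union> J)] @ map H Js @ [H T])"
    by (rule linear_map_on_mem[OF tensor_map_tensor_linear[OF _ m linear_map_on_id] t]) (use sub in auto)
  then have "mul_iter ((I # J # Js) @ [T]) t = mul (K - T) T (tensor_map (map H ((I \<union> J) # Js)) [H T]
      (vec \<circ> mul_iter ((I \<union> J) # Js)) id
      (tensor_map ([H I, H J] @ map H Js) [H T] (tensor_map [H I, H J] (map H Js) (mulT I J) id) id t))"
    using 2(1)[OF _ 2(3)] set_compositions_merge[OF 2(2)[simplified]] by (simp add: eq[unfolded id_def] comp_def id_def)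
  also have "\<dots> = mul (K - T) T (tensor_map ([H I, H J] @ map H Js) [H T]
      ((vec \<circ> mul_iter ((I \<union> J) # Js)) \<circ> tensor_map [H I, H J] (map H Js) (mulT I J) id) (id \<circ> id) t)"
  proof (rule arg_cong[where f = "mul (K - T) T"], rule tensor_map_compose)
    show "tensor_linear ([H I, H J] @ map H Js) (map H ((I \<union> J) # Js)) (tensor_map [H I, H J] (map H Js) (mulT I J) id)"
      using lin by simp
    show "tensor_linear (map H ((I \<union> J) # Js)) [H (K - T)] (vec \<circ> mul_iter ((I \<union> J) # Js))"
      by (rule linear_map_on_compose[OF mul_iter_linear vec_linear]) (use comp set_compositions_merge in auto)
  qed (use sub sub' t linear_map_on_id in auto)
  finally show ?case by (simp add: comp_def id_def)
qed simp

text \<open>The coproduct that is applied first already splits off \<open>T\<close>; all later ones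
  act on the factors before it, so they gather into \<open>com_iter Js\<close>.\<close>

lemma com_iter_snoc:
  assumes "Js @ [T] \<in> set_compositions K" "finite K" "Js \<noteq> []" and x: "x \<in> H K"
  shows "com_iter (Js @ [T]) x = tensor_map [H (K - T)] [H T] (com_iter Js \<circ> unvec) id (com (K - T) T x)"
  using assms(1-3)
proof (induction Js rule: com_iter.induct)
  case (1 L)
  then have L: "L = K - T" "finite T" "finite (K - T)" and K: "(K - T) \<union> T = K"
    by (auto simp: set_compositions_Cons set_compositions_Nil intro: finite_subset)
  have t: "com (K - T) T x \<in> tensor_space [H (K - T), H T]"
    using linear_map_on_mem[OF com_linear, of "K - T" T x] L K x by auto
  have sub: "\<forall>U\<in>set [H (K - T), H T]. subspace U" using L subspace_H by simp
  have "tensor_map [H (K - T)] [H T] (vec \<circ> unvec) id (com (K - T) T x) = tensor_map [H (K - T)] [H T] id id (com (K - T) T x)"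
    by (rule tensor_map_cong[where Us' = "[H (K - T)]" and Vs' = "[H T]"])
      (use sub t in \<open>simp_all add: vec_unvec[where U = "H (K - T)"] linear_map_on_id linear_map_on_compose[OF unvec_linear vec_linear]\<close>)
  also have "\<dots> = com (K - T) T x" by (rule tensor_map_id) (use sub t in simp_all)
  also have "com (K - T) T x = tensor_map [H K] [] (comT (K - T) T) id (vec x)"
    using tensor_map_Nil[OF _ comT_linear vec_in_space, of "K - T" T x] x L K subspace_H[OF 1(2)]
    by (simp add: comT_def Int_commute)
  finally show ?case using L K by (simp add: comp_def id_def)
next
  case (2 I J Js)
  have comp: "I # J # Js \<in> set_compositions (K - T)" "finite (K - T)" and T: "T \<subseteq> K"
    using 2(2,3) set_compositions_snoc[of "I # J # Js"] by simp_all
  have K: "(K - T) \<union> T = K" "finite T" using T 2(3) by (auto intro: finite_subset)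
  have fin: "finite I" "finite J" "I \<inter> J = {}"
    using 2 by (auto simp: set_compositions_Cons intro: finite_subset)
  note sub = subspaces_composition[OF set_compositions_merge[OF 2(2)[simplified]] 2(3)]
  note sub' = subspaces_composition[OF comp]
  note m = comT_linear[OF fin]
  have c: "com (K - T) T x \<in> tensor_space ([H (K - T)] @ [H T])"
    using linear_map_on_mem[OF com_linear, of "K - T" T x] comp(2) K x by auto
  have ci: "tensor_linear [H (K - T)] ([H (I \<union> J)] @ map H Js) (com_iter ((I \<union> J) # Js) \<circ> unvec)"
    using linear_map_on_compose[OF unvec_linear[OF subspace_H[OF comp(2)]]
       com_iter_linear[OF set_compositions_merge[OF comp(1)] comp(2)]] by simp
  define t where "t = tensor_map [H (K - T)] [H T] (com_iter ((I \<union> J) # Js) \<circ> unvec) id (com (K - T) T x)"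
  have sKT: "\<forall>U\<in>set ([H (K - T)] @ [H T]). subspace U" using comp(2) K subspace_H by simp
  have t: "t \<in> tensor_space ([H (I \<union> J)] @ map H Js @ [H T])"
    using linear_map_on_mem[OF tensor_map_tensor_linear[OF sKT ci linear_map_on_id] c] by (simp add: t_def)
  have lin: "tensor_linear ([H (I \<union> J)] @ map H Js) ([H I, H J] @ map H Js)
      (tensor_map [H (I \<union> J)] (map H Js) (comT I J) id)"
    by (rule tensor_map_tensor_linear[OF _ m linear_map_on_id]) (use sub in auto)
  have "com_iter ((I # J # Js) @ [T]) x = tensor_map [H (I \<union> J)] (map H Js @ [H T]) (comT I J) id t"
    using 2(1)[OF _ 2(3)] set_compositions_merge[OF 2(2)[simplified]] by (simp add: t_def comp_def id_def)
  also have "\<dots> = tensor_map ([H (I \<union> J)] @ map H Js) [H T] (tensor_map [H (I \<union> J)] (map H Js) (comT I J) id) id t"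
    by (rule tensor_map_id_right[OF _ m t]) (use sub in auto)
  also have "\<dots> = tensor_map [H (K - T)] [H T] (tensor_map [H (I \<union> J)] (map H Js) (comT I J) id \<circ>
      (com_iter ((I \<union> J) # Js) \<circ> unvec)) (id \<circ> id) (com (K - T) T x)"
    unfolding t_def
    by (rule tensor_map_compose[OF sKT _ ci linear_map_on_id lin linear_map_on_id c]) (use sub in auto)
  finally show ?case by (simp add: comp_def id_def)
qed simp

text \<open>This is what makes the alternating sum recursive: the summand of \<open>Js @ [T]\<close>
  is the summand of \<open>Js\<close> convolved with the identity on \<open>T\<close>.\<close>

lemma mul_com_iter_snoc:
  assumes Js: "Js @ [T] \<in> set_compositions K" "finite K" "Js \<noteq> []" and x: "x \<in> H K"
  shows "mul_iter (Js @ [T]) (com_iter (Js @ [T]) x) = mul (K - T) T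
    (tensor_map [H (K - T)] [H T] (vec \<circ> (\<lambda>y. mul_iter Js (com_iter Js y)) \<circ> unvec) id (com (K - T) T x))"
proof -
  have comp: "Js \<in> set_compositions (K - T)" "finite (K - T)" and T: "T \<subseteq> K"
    using Js(1,2) by (simp_all add: set_compositions_snoc)
  have K: "(K - T) \<union> T = K" "finite T" using T Js(2) by (auto intro: finite_subset)
  have sKT: "\<forall>U\<in>set ([H (K - T)] @ [H T]). subspace U" using comp(2) K subspace_H by simp
  have c: "com (K - T) T x \<in> tensor_space ([H (K - T)] @ [H T])"
    using linear_map_on_mem[OF com_linear, of "K - T" T x] comp(2) K x by auto
  have ci: "tensor_linear [H (K - T)] (map H Js) (com_iter Js \<circ> unvec)"
    by (rule linear_map_on_compose[OF unvec_linear[OF subspace_H[OF comp(2)]] com_iter_linear[OF comp Js(3)]])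
  have mi: "tensor_linear (map H Js) [H (K - T)] (vec \<circ> mul_iter Js)"
    by (rule linear_map_on_compose[OF mul_iter_linear[OF comp Js(3)] vec_linear])
  have "mul_iter (Js @ [T]) (com_iter (Js @ [T]) x) =
    mul (K - T) T (tensor_map (map H Js) [H T] (vec \<circ> mul_iter Js) id (com_iter (Js @ [T]) x))"
    by (rule mul_iter_snoc[OF Js linear_map_on_mem[OF com_iter_linear[OF Js(1,2)] x]]) simp
  also have "tensor_map (map H Js) [H T] (vec \<circ> mul_iter Js) id (com_iter (Js @ [T]) x) =
    tensor_map [H (K - T)] [H T] ((vec \<circ> mul_iter Js) \<circ> (com_iter Js \<circ> unvec)) (id \<circ> id) (com (K - T) T x)"
    unfolding com_iter_snoc[OF Js x]
    by (rule tensor_map_compose[OF sKT _ ci linear_map_on_id mi linear_map_on_id c])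
      (use sKT subspaces_composition[OF comp] in auto)
  finally show ?thesis by (simp add: comp_def id_def)
qed

lemma mul_com_iter_linear:
  assumes Js: "Js \<in> set_compositions K" "finite K" "Js \<noteq> []"
  shows "linear_map_on scale scale (H K) (H K) (\<lambda>x. mul_iter Js (com_iter Js x))"
  using linear_map_on_compose[OF com_iter_linear[OF Js] mul_iter_linear[OF Js]] by (simp add: o_def)

section \<open>Linearity of \<Psi>, its recursion, and its values on primitives\<close>

lemma Psi_linear:
  assumes K: "finite K" "k \<in> K"
  shows "linear_map_on scale scale (H K) (H K) (Psi k K)"
proof -
  note H = subspace_H[OF K(1)]
  have "linear_map_on scale scale (H K) (H K)
    (\<lambda>x. \<Sum>Js | Js \<in> set_compositions K \<and> k \<in> hd Js. ((- 1) ^ (length Js - 1)) *s mul_iter Js (com_iter Js x))"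
    using K
    by (intro linear_map_on_sum_fun linear_map_on_scale_fun mul_com_iter_linear vector_space_axioms
        subspace_0[OF H] subspace_add[OF H] subspace_scale[OF H])
      (auto simp: set_compositions_Nil)
  then show ?thesis by (simp add: Psi_def[abs_def])
qed

lemma PsiT_linear:
  assumes "finite K" "k \<in> K"
  shows "tensor_linear [H K] [H K] (PsiT k K)"
  using linear_map_on_compose[OF linear_map_on_compose[OF unvec_linear Psi_linear] vec_linear] assms subspace_H
  by (simp add: o_assoc)

text \<open>The composition \<open>[K]\<close> contributes \<open>x\<close>. The others are grouped
  by the set \<open>S\<close> that remains when the last block is removed; the additional block
  reverses the sign, which yields the minus in front of the sum.\<close>

lemma Psi_rec:
  assumes K: "finite K" "k \<in> K" and x: "x \<in> H K"
  shows "Psi k K x = x - (\<Sum>S | k \<in> S \<and> S \<subset> K. Psi_conv k S (K - S) x)"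
proof -
  define C where "C S = {Js \<in> set_compositions S. k \<in> hd Js}" for S
  define R where "R = {S. k \<in> S \<and> S \<subset> K}"
  define E where "E Js x = mul_iter Js (com_iter Js x)" for Js x
  let ?f = "\<lambda>(S, Js). Js @ [K - S]"
  let ?g = "\<lambda>Js. ((- 1) ^ (length Js - 1)) *s E Js x"
  have finR: "finite R" by (rule finite_subset[of _ "Pow K"]) (use K(1) in \<open>auto simp: R_def\<close>)
  have fin: "finite S" if "S \<in> R" for S using that K(1) by (auto simp: R_def intro: finite_subset)
  have finC: "finite (C S)" if "S \<in> R" for S
    using finite_set_compositions[OF fin[OF that]] by (simp add: C_def)
  have "inj_on ?f (Sigma R C)"
    by (auto simp: inj_on_def R_def C_def)
  have nN: "Js \<noteq> []" if "S \<in> R" "Js \<in> C S" for S Js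
    using that by (auto simp: R_def C_def set_compositions_Nil)
  \<comment> \<open>Lists in the image have at least two blocks.\<close>
  have "[K] \<notin> ?f ` Sigma R C"
    using nN by fastforce
  moreover have "{Js. Js \<in> set_compositions K \<and> k \<in> hd Js} = insert [K] (?f ` Sigma R C)"
    using set_compositions_hd_split[OF K(2)] unfolding R_def C_def by simp
  moreover have "finite (?f ` Sigma R C)"
    using finR finC by blast
  ultimately have "Psi k K x = ?g [K] + (\<Sum>Js\<in>?f ` Sigma R C. ?g Js)"
    unfolding Psi_def E_def[symmetric] by simp
  also have "(\<Sum>Js\<in>?f ` Sigma R C. ?g Js) = (\<Sum>(S, Js)\<in>Sigma R C. ?g (Js @ [K - S]))"
    by (subst sum.reindex) (use \<open>inj_on ?f (Sigma R C)\<close> in \<open>auto simp: case_prod_unfold intro!: sum.cong\<close>)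
  also have "\<dots> = (\<Sum>S\<in>R. \<Sum>Js\<in>C S. ?g (Js @ [K - S]))"
    using finR finC by (simp add: sum.Sigma)
  also have "\<dots> = (\<Sum>S\<in>R. - Psi_conv k S (K - S) x)"
  proof (rule sum.cong[OF refl])
    fix S assume S: "S \<in> R"
    define T where "T = K - S"
    have KS: "S = K - T" "S \<union> T = K" "S \<inter> T = {}" "finite T" "T \<noteq> {}" "T \<subseteq> K" "k \<in> S"
      using S K(1) by (auto simp: R_def T_def)
    have sub: "\<forall>U\<in>set ([H S] @ [H T]). subspace U" using fin[OF S] KS subspace_H by simp
    have c: "com S T x \<in> tensor_space ([H S] @ [H T])"
      using linear_map_on_mem[OF com_linear[OF fin[OF S] KS(4,3)]] x KS(2) by simp
    let ?E = "\<lambda>Js. vec \<circ> E Js \<circ> unvec"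
    have lin: "tensor_linear [H S] [H S] (?E Js)" if "Js \<in> C S" for Js
      unfolding E_def[abs_def] using that nN[OF S that] fin[OF S] subspace_H[OF fin[OF S]]
      by (intro linear_map_on_compose[OF linear_map_on_compose[OF _ mul_com_iter_linear] vec_linear, unfolded o_assoc] unvec_linear)
        (auto simp: C_def)
    have lin': "tensor_linear [H S] [H S] (\<lambda>t. tscale ((- 1) ^ (length Js - 1)) (?E Js t))" if "Js \<in> C S" for Js
      by (rule linear_map_on_scale_fun[OF tensor.vector_space_axioms lin[OF that] tensor_space_scale])
    \<comment> \<open>Written as a sum of linear maps, \<open>PsiT k S\<close> can be pulled out of
      \<open>tensor_map\<close> and \<open>mul\<close> one composition at a time.\<close>
    have Psi: "PsiT k S t = (\<Sum>Js\<in>C S. tscale ((- 1) ^ (length Js - 1)) (?E Js t))" for t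
    proof -
      have "PsiT k S t = vec (\<Sum>Js\<in>C S. ((- 1) ^ (length Js - 1)) *s E Js (unvec t))"
        by (simp add: Psi_def C_def E_def)
      also have "\<dots> = (\<Sum>Js\<in>C S. vec (((- 1) ^ (length Js - 1)) *s E Js (unvec t)))"
        by (rule linear_map_on_sum[OF vec_linear[of UNIV]]) auto
      finally show ?thesis by (simp add: vec_scale)
    qed
    have "tensor_map [H S] [H T] (PsiT k S) id (com S T x) =
      (\<Sum>Js\<in>C S. tensor_map [H S] [H T] (\<lambda>t. tscale ((- 1) ^ (length Js - 1)) (?E Js t)) id (com S T x))"
      unfolding Psi[abs_def, folded o_def] 
      by (subst tensor_map_sum_left[OF sub lin' linear_map_on_id c, symmetric]) (simp_all add: Psi[abs_def] o_def)
    also have "\<dots> = (\<Sum>Js\<in>C S. tscale ((- 1) ^ (length Js - 1)) (tensor_map [H S] [H T] (?E Js) id (com S T x)))"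
      by (intro sum.cong refl tensor_map_scale_left[OF sub lin linear_map_on_id c])
    finally have "Psi_conv k S T x =
      mul S T (\<Sum>Js\<in>C S. tscale ((- 1) ^ (length Js - 1)) (tensor_map [H S] [H T] (?E Js) id (com S T x)))"
      by simp
    also have "\<dots> = (\<Sum>Js\<in>C S. mul S T (tscale ((- 1) ^ (length Js - 1)) (tensor_map [H S] [H T] (?E Js) id (com S T x))))"
      using linear_map_on_mem[OF tensor_map_tensor_linear[OF sub lin linear_map_on_id] c]
      by (intro linear_map_on_sum[OF mul_linear[OF fin[OF S] KS(4,3)] tensor_space_zero])
        (auto intro: tensor_space_add tensor_space_scale)
    also have "\<dots> = (\<Sum>Js\<in>C S. - ?g (Js @ [T]))"
    proof (rule sum.cong[OF refl])
      fix Js assume Js: "Js \<in> C S"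
      then have Jc: "Js @ [T] \<in> set_compositions K"
        using KS by (auto simp: set_compositions_snoc C_def)
      have "tensor_map [H S] [H T] (?E Js) id (com S T x) \<in> tensor_space [H S, H T]"
        using linear_map_on_mem[OF tensor_map_tensor_linear[OF sub lin[OF Js] linear_map_on_id] c] by simp
      then have "mul S T (tscale ((- 1) ^ (length Js - 1)) (tensor_map [H S] [H T] (?E Js) id (com S T x))) =
        ((- 1) ^ (length Js - 1)) *s E (Js @ [T]) x"
        using mul_com_iter_snoc[OF Jc K(1) nN[OF S Js] x, folded KS(1)]
        by (simp add: linear_map_on_scale[OF mul_linear[OF fin[OF S] KS(4,3)]] E_def[abs_def])
      \<comment> \<open>The exponent uses truncated subtraction; since \<open>Js\<close> is
        nonempty, it really grows by one when \<open>T\<close> is appended.\<close>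
      also have "\<dots> = - ?g (Js @ [T])"
        using nN[OF S Js] by (cases Js) simp_all
      finally show "mul S T (tscale ((- 1) ^ (length Js - 1)) (tensor_map [H S] [H T] (?E Js) id (com S T x))) = - ?g (Js @ [T])" .
    qed
    finally show "(\<Sum>Js\<in>C S. ?g (Js @ [K - S])) = - Psi_conv k S (K - S) x"
      by (simp add: T_def sum_negf)
  qed
  also have "?g [K] = x" by (simp add: E_def)
  finally show ?thesis by (simp add: sum_negf R_def comp_def id_def)
qed

text \<open>In \<open>Psi_rec\<close> each \<open>S\<close> contains \<open>k\<close> and has
  nonempty complement, so \<open>[S, K - S]\<close> is a composition whose coproduct kills a
  primitive element. Only the term \<open>x\<close> survives.\<close>

lemma Psi_primitive_id:
  assumes K: "finite K" "k \<in> K" and x: "x \<in> primitives K"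
  shows "Psi k K x = x"
proof -
  have "Psi_conv k S (K - S) x = 0" if S: "k \<in> S" "S \<subset> K" for S
  proof -
    have fin: "finite S" "finite (K - S)" "S \<inter> (K - S) = {}" using S K by (auto intro: finite_subset)
    have "[S, K - S] \<in> set_compositions K"
      using S by (auto simp: set_compositions_Cons set_compositions_Nil)
    then have "com S (K - S) x = 0" using x by (simp add: primitives_def)
    moreover have "\<forall>U\<in>set ([H S] @ [H (K - S)]). subspace U" using fin subspace_H by simp
    ultimately show ?thesis
      using linear_map_on_zero[OF tensor_map_tensor_linear[OF _ PsiT_linear[OF fin(1) S(1)] linear_map_on_id] tensor_space_zero]
        linear_map_on_zero[OF mul_linear[OF fin] tensor_space_zero]
      by simp
  qed
  then show ?thesis using Psi_rec[OF K] x by (simp add: primitives_def)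
qed

end

section \<open>Primitivity\<close>

context connected_hopf_monoid
begin

text \<open>By connectedness \<open>H {}\<close> is spanned by \<open>unit_elt\<close>, so the
  coproduct has the form \<open>vec y \<otimes> vec unit_elt\<close>; the counit axiom then forces
  \<open>y = x\<close>.\<close>

lemma com_empty_right:
  assumes S: "finite S" and x: "x \<in> H S"
  shows "com S {} x = vec x \<otimes> vec unit_elt"
proof -
  have sub: "subspace (H S)" "subspace (H {})" using S subspace_H by auto
  have "\<exists>y\<in>H S. t = vec y \<otimes> vec unit_elt" if "t \<in> tensor_space ([H S] @ [H {}])" for t
    using that
  proof (induction rule: tensor_space_append_induct)
    case zero
    have "vec 0 = 0" by (rule linear_map_on_zero[OF vec_linear[of UNIV]]) simp
    then show ?case using subspace_0[OF sub(1)] tensor_times_zero_left by metis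
  next
    case (add t u)
    then show ?case using subspace_add[OF sub(1)] tensor_times_linear(1) vec_add by metis
  next
    case (scale c t)
    then show ?case using subspace_scale[OF sub(1)] tensor_times_linear(2) vec_scale by metis
  next
    case (times t u)
    then obtain y z where yz: "t = vec y" "y \<in> H S" "u = vec z" "z \<in> H {}"
      by (auto simp: tensor_space_singleton sub)
    \<comment> \<open>The scalar moves across the tensor product into the factor
      \<open>H S\<close>.\<close>
    then obtain c where "z = c *s unit_elt" by (auto simp: connected span_singleton)
    then have "t \<otimes> u = vec (c *s y) \<otimes> vec unit_elt"
      using tensor_times_linear(4)[OF vec_in_space[OF yz(2)] vec_in_space[OF unit_in]] yz
      by (simp add: vec_scale tensor_times_linear(2))
    then show ?case using subspace_scale[OF sub(1) yz(2)] by blast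
  qed
  moreover have "com S {} x \<in> tensor_space ([H S] @ [H {}])"
    using linear_map_on_mem[OF com_linear[OF S, of "{}"]] x by simp
  ultimately obtain y where y: "y \<in> H S" "com S {} x = vec y \<otimes> vec unit_elt" by blast
  \<comment> \<open>The ground field appears as the empty tensor product, so applying
    \<open>counitT\<close> to the second factor leaves a one-fold tensor.\<close>
  have cu: "linear_map_on tscale tscale (tensor_space [H {}]) (tensor_space []) counitT"
    using counit_linear linear_map_on_mem[OF unvec_linear[OF sub(2)]]
    by (auto simp: linear_map_on_def counitT_def tensor.scale_left_distrib tensor_space_scale pure_in_space
        linear_map_on_add[OF unvec_linear[OF sub(2)]] linear_map_on_scale[OF unvec_linear[OF sub(2)]])
  have "tensor_map [H S] [H {}] id counitT (com S {} x) = vec y \<otimes> counitT (vec unit_elt)"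
    unfolding y(2) using tensor_map_times[OF _ linear_map_on_id cu vec_in_space[OF y(1)] vec_in_space[OF unit_in]] sub
    by simp
  also have "\<dots> = vec y"
    using tensor_times_pure_Nil[OF vec_in_space[OF y(1)]] by (simp add: counitT_def counit_unit)
  finally show ?thesis using counit_right[OF S x] y inj_vec by (simp add: inj_eq)
qed

text \<open>The term \<open>S = K\<close> is \<open>Psi k K x\<close>, by
  \<open>com_empty_right\<close> and the right unit law. Adding the remaining terms undoes the
  subtraction in \<open>Psi_rec\<close>.\<close>

lemma Psi_conv_sum:
  assumes K: "finite K" "k \<in> K" and x: "x \<in> H K"
  shows "(\<Sum>S | k \<in> S \<and> S \<subseteq> K. Psi_conv k S (K - S) x) = x"
proof -
  have sub: "\<forall>U\<in>set ([H K] @ [H {}]). subspace U" using K subspace_H by simp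
  note Psi_in = linear_map_on_mem[OF Psi_linear[OF K] x]
  have "{S. k \<in> S \<and> S \<subseteq> K} = insert K {S. k \<in> S \<and> S \<subset> K}" using K by auto
  moreover have "finite {S. k \<in> S \<and> S \<subset> K}"
    by (rule finite_subset[of _ "Pow K"]) (use K in auto)
  ultimately have "(\<Sum>S | k \<in> S \<and> S \<subseteq> K. Psi_conv k S (K - S) x) =
      Psi_conv k K {} x + (\<Sum>S | k \<in> S \<and> S \<subset> K. Psi_conv k S (K - S) x)"
    by simp
  also have "Psi_conv k K {} x = Psi k K x"
    using tensor_map_times[OF sub PsiT_linear[OF K] linear_map_on_id vec_in_space[OF x] vec_in_space[OF unit_in]]
      unit_right[OF K(1) Psi_in] com_empty_right[OF K(1) x] by simp
  finally show ?thesis using Psi_rec[OF K x] by (simp add: comp_def id_def)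
qed

text \<open>A primitive element on \<open>S\<close> is cut by \<open>(A, B)\<close> only trivially, so compatibility moves it into
  the factor \<open>A\<close> that meets \<open>S\<close>.\<close>

lemma com_mul_primitive:
  assumes fin: "finite S" "finite T" and dis: "S \<inter> T = {}" "A \<inter> B = {}" "S \<union> T = A \<union> B"
    and k: "k \<in> S" "k \<in> A" and p: "p \<in> primitives S" and y: "y \<in> H T"
  shows "com A B (mul S T (vec p \<otimes> vec y)) =
    (if S \<subseteq> A then tensor_map [H S, H (A - S)] [H B] (mulT S (A - S)) id (vec p \<otimes> com (A - S) B y) else 0)"
proof -
  \<comment> \<open>The four blocks of the compatibility axiom: a table with rows \<open>S\<close>,
    \<open>T\<close> and columns \<open>A\<close>, \<open>B\<close>.\<close>
  define A' B' C D where "A' = S \<inter> A" and "B' = S \<inter> B" and "C = T \<inter> A" and "D = T \<inter> B"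
  note defs = A'_def B'_def C_def D_def
  have fins: "finite A'" "finite B'" "finite C" "finite D" using fin by (auto simp: defs)
  have un: "A' \<union> B' = S" "C \<union> D = T" "A' \<union> C = A" "B' \<union> D = B" and
    int: "A' \<inter> B' = {}" "C \<inter> D = {}" "A' \<inter> C = {}" "B' \<inter> D = {}"
    using dis by (auto simp: defs)
  have pS: "p \<in> H S" using p by (simp add: primitives_def)
  have sub: "\<forall>U\<in>set ([H S] @ [H T]). subspace U" "\<forall>U\<in>set ([H A', H C] @ [H B', H D]). subspace U"
    "\<forall>U\<in>set ([H A'] @ [H B', H C, H D]). subspace U" "\<forall>U\<in>set ([H B', H C] @ [H D]). subspace U"
    using fin fins subspace_H by auto
  have c1: "tensor_linear [H S] [H A', H B'] (comT A' B')" "tensor_linear [H T] [H C, H D] (comT C D)"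
    using comT_linear[OF fins(1,2) int(1)] comT_linear[OF fins(3,4) int(2)] by (simp_all add: un)
  have m1: "tensor_linear [H A', H C] [H A] (mulT A' C)" "tensor_linear [H B', H D] [H B] (mulT B' D)"
    using mulT_linear[OF fins(1,3) int(3)] mulT_linear[OF fins(2,4) int(4)] by (simp_all add: un)
  note br = braiding_linear[OF subspace_H[OF fins(2)] subspace_H[OF fins(3)]]
  have b1: "tensor_linear ([H B', H C] @ [H D]) ([H C, H B'] @ [H D]) (tensor_map [H B', H C] [H D] (braiding (H B') (H C)) id)"
    by (rule tensor_map_tensor_linear[OF sub(4) br(1) linear_map_on_id])
  then have b1: "tensor_linear [H B', H C, H D] [H C, H B', H D] (tensor_map [H B', H C] [H D] (braiding (H B') (H C)) id)"
    by simp
  have b2: "tensor_linear ([H A'] @ [H B', H C, H D]) ([H A'] @ [H C, H B', H D])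
      (tensor_map [H A'] [H B', H C, H D] id (tensor_map [H B', H C] [H D] (braiding (H B') (H C)) id))"
    by (rule tensor_map_tensor_linear[OF sub(3) linear_map_on_id b1])
  have m2: "tensor_linear ([H A', H C] @ [H B', H D]) ([H A] @ [H B]) (tensor_map [H A', H C] [H B', H D] (mulT A' C) (mulT B' D))"
    by (rule tensor_map_tensor_linear[OF sub(2) m1])
  \<comment> \<open>What compatibility does after the two coproducts: braid the middle factors, then
    multiply in pairs.\<close>
  define F where "F = tensor_map [H A', H C] [H B', H D] (mulT A' C) (mulT B' D) \<circ>
        tensor_map [H A'] [H B', H C, H D] id (tensor_map [H B', H C] [H D] (braiding (H B') (H C)) id)"
  have F_lin: "tensor_linear ([H A', H B'] @ [H C, H D]) ([H A] @ [H B]) F"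
    unfolding F_def using linear_map_on_compose[OF b2] m2 by simp
  have eq: "com A B (mul S T (vec p \<otimes> vec y)) = F (com A' B' p \<otimes> com C D y)"
    using compat[OF _ dis(1) dis(2) dis(3) A'_def B'_def C_def D_def, of "vec p \<otimes> vec y"] fin
      tensor_times_in_space[OF vec_in_space[OF pS] vec_in_space[OF y]]
      tensor_map_times[OF sub(1) c1 vec_in_space[OF pS] vec_in_space[OF y]]
    by (simp add: F_def comT_def)
  show ?thesis
  proof (cases "S \<subseteq> A")
    case False
    \<comment> \<open>\<open>A'\<close> contains \<open>k\<close>, and \<open>B'\<close> contains
      the part of \<open>S\<close> outside \<open>A\<close>. Hence \<open>[A', B']\<close> is a
      composition of \<open>S\<close>, and its coproduct kills the primitive
      \<open>p\<close>.\<close>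
    then have "B' \<noteq> {}" "A' \<noteq> {}" using dis k by (auto simp: defs)
    then have "[A', B'] \<in> set_compositions S"
      using un int by (auto simp: set_compositions_Cons set_compositions_Nil)
    then have "com A' B' p = 0" using p by (simp add: primitives_def)
    then show ?thesis
      using False linear_map_on_zero[OF F_lin tensor_space_zero] by (simp add: eq tensor_times_zero_left)
  next
    case True
    then have e: "A' = S" "B' = {}" "C = A - S" "D = B" using dis by (auto simp: defs)
    have cp: "com A' B' p = vec p \<otimes> vec unit_elt"
      unfolding e by (rule com_empty_right[OF fin(1) pS])
    have sub': "\<forall>U\<in>set ([H S, H (A - S)] @ [H B]). subspace U" using sub(2) by (simp add: e)
    have m: "tensor_linear [H S, H (A - S)] [H A] (mulT S (A - S))" using m1(1) by (simp add: e)
    have R: "tensor_linear ([H S, H (A - S)] @ [H B]) ([H A] @ [H B])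
        (tensor_map [H S, H (A - S)] [H B] (mulT S (A - S)) id)"
      by (rule tensor_map_tensor_linear[OF sub' m linear_map_on_id])
    note vp = vec_in_space[OF pS] and v1 = vec_in_space[OF unit_in]
    have vp1: "com A' B' p \<in> tensor_space [H A', H B']"
      using tensor_times_in_space[OF vp v1] cp by (simp add: e)
    \<comment> \<open>The coproduct of \<open>y\<close> is in general a sum of products; with
      \<open>u\<close> arbitrary in its place, linearity reduces the claim to products.\<close>
    have "F (com A' B' p \<otimes> u) =
        tensor_map [H S, H (A - S)] [H B] (mulT S (A - S)) id (vec p \<otimes> u)"
      if "u \<in> tensor_space ([H C] @ [H D])" for u
      using that
    proof (induction rule: tensor_space_append_induct)
      case zero
      show ?case
        using linear_map_on_zero[OF F_lin tensor_space_zero] linear_map_on_zero[OF R tensor_space_zero]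
        by (simp add: tensor_times_zero_right[OF vp1] tensor_times_zero_right[OF vp] id_def)
    next
      case (add t u)
      then show ?case
        using linear_map_on_add[OF F_lin tensor_times_in_space[OF vp1] tensor_times_in_space[OF vp1], of t u]
          linear_map_on_add[OF R, of "vec p \<otimes> t" "vec p \<otimes> u"]
          tensor_times_in_space[OF vp add(1)] tensor_times_in_space[OF vp add(2)]
        by (simp add: tensor_times_linear(3)[OF vp1[unfolded e] add(1,2)] tensor_times_linear(3)[OF vp add(1,2)] e id_def)
    next
      case (scale c t)
      then show ?case
        using linear_map_on_scale[OF F_lin tensor_times_in_space[OF vp1], of t c]
          linear_map_on_scale[OF R, of "vec p \<otimes> t" c]
          tensor_times_in_space[OF vp scale(1)]
        by (simp add: tensor_times_linear(4)[OF vp1[unfolded e] scale(1)] tensor_times_linear(4)[OF vp scale(1)] e id_def)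
    next
      case (times t u)
      then obtain c d where cd: "t = vec c" "c \<in> H C" "u = vec d" "d \<in> H D"
        using sub by (auto simp: tensor_space_singleton)
      note vc = times(1)[unfolded cd] and vd = times(2)[unfolded cd]
      \<comment> \<open>\<open>B'\<close> is empty, so its factor is the unit. The braiding carries
        it past \<open>c\<close>, and multiplication with \<open>d\<close> absorbs it.\<close>
      have 1: "tensor_map [H B', H C] [H D] (braiding (H B') (H C)) id ((vec unit_elt \<otimes> vec c) \<otimes> vec d) =
          (vec c \<otimes> vec unit_elt) \<otimes> vec d"
        using tensor_map_times[OF sub(4) br(1) linear_map_on_id, of "vec unit_elt \<otimes> vec c" "vec d"]
          tensor_times_in_space[OF v1 vc] vd br(2)[of unit_elt c] cd unit_in by (simp add: e)
      have v1cd: "(vec unit_elt \<otimes> vec c) \<otimes> vec d \<in> tensor_space [H B', H C, H D]"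
        using tensor_times_in_space[OF tensor_times_in_space[OF v1 vc] vd] by (simp add: e)
      have "tensor_map [H A'] [H B', H C, H D] id (tensor_map [H B', H C] [H D] (braiding (H B') (H C)) id)
          (vec p \<otimes> ((vec unit_elt \<otimes> vec c) \<otimes> vec d)) = vec p \<otimes> ((vec c \<otimes> vec unit_elt) \<otimes> vec d)"
        using tensor_map_times[OF sub(3) linear_map_on_id b1, of "vec p" "(vec unit_elt \<otimes> vec c) \<otimes> vec d"] vp v1cd 1
        by (simp add: e)
      moreover have "(vec p \<otimes> vec unit_elt) \<otimes> (vec c \<otimes> vec d) = vec p \<otimes> ((vec unit_elt \<otimes> vec c) \<otimes> vec d)"
        using tensor_times_assoc[OF vp v1 tensor_times_in_space[OF vc vd]] tensor_times_assoc[OF v1 vc vd] by simp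
      moreover have "vec p \<otimes> ((vec c \<otimes> vec unit_elt) \<otimes> vec d) = (vec p \<otimes> vec c) \<otimes> (vec unit_elt \<otimes> vec d)"
        using tensor_times_assoc[OF vp vc tensor_times_in_space[OF v1 vd]] tensor_times_assoc[OF vc v1 vd] by simp
      ultimately have "F (com A' B' p \<otimes> (vec c \<otimes> vec d)) = tensor_map [H A', H C] [H B', H D] (mulT A' C) (mulT B' D)
          ((vec p \<otimes> vec c) \<otimes> (vec unit_elt \<otimes> vec d))"
        by (simp add: F_def cp)
      also have "\<dots> = mulT A' C (vec p \<otimes> vec c) \<otimes> mulT B' D (vec unit_elt \<otimes> vec d)"
        by (rule tensor_map_times[OF sub(2) m1])
          (use tensor_times_in_space[OF vp vc] tensor_times_in_space[OF v1 vd] in \<open>simp_all add: e\<close>)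
      also have "\<dots> = mulT S (A - S) (vec p \<otimes> vec c) \<otimes> vec d"
        using unit_left[OF fins(4) cd(4)] by (simp add: mulT_def e)
      also have "\<dots> = tensor_map [H S, H (A - S)] [H B] (mulT S (A - S)) id ((vec p \<otimes> vec c) \<otimes> vec d)"
        using tensor_map_times[OF sub' m linear_map_on_id, of "vec p \<otimes> vec c" "vec d"] tensor_times_in_space[OF vp vc] vd
        by (simp add: e)
      also have "(vec p \<otimes> vec c) \<otimes> vec d = vec p \<otimes> (vec c \<otimes> vec d)"
        by (rule tensor_times_assoc[OF vp vc vd])
      finally show ?case by (simp add: cd)
    qed
    moreover have "com C D y \<in> tensor_space ([H C] @ [H D])"
      using linear_map_on_mem[OF com_linear[OF fins(3,4) int(2)], of y] y by (simp add: un)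
    ultimately show ?thesis using True by (simp add: eq) (simp add: e)
  qed
qed

text \<open>Linearity reduces the left side to products, where primitivity of the image of
  \<open>Psi k S\<close> brings in \<open>com_mul_primitive\<close>. If
  \<open>S \<subseteq> A\<close>, coassociativity then moves all further operations into the
  \<open>A\<close> factor of \<open>com A B x\<close>.\<close>

lemma com_Psi_conv:
  assumes fin: "finite A" "finite B" and dis: "A \<inter> B = {}" "S \<inter> T = {}" "S \<union> T = A \<union> B"
    and k: "k \<in> S" "k \<in> A" and prim: "\<And>y. y \<in> H S \<Longrightarrow> Psi k S y \<in> primitives S"
    and x: "x \<in> H (A \<union> B)"
  shows "com A B (Psi_conv k S T x) =
    (if S \<subseteq> A then tensor_map [H A] [H B] (vec \<circ> Psi_conv k S (A - S) \<circ> unvec) id (com A B x) else 0)"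
proof -
  have "finite (S \<union> T)" using fin dis by simp
  then have finST: "finite S" "finite T" by simp_all
  let ?C = "A - S"
  have sST: "\<forall>U\<in>set ([H S] @ [H T]). subspace U" using finST subspace_H by auto
  note P = PsiT_linear[OF finST(1) k(1)]
  have cx: "com S T x \<in> tensor_space ([H S] @ [H T])"
    using linear_map_on_mem[OF com_linear[OF finST dis(2)]] x dis(3) by simp
  have L0: "linear_map_on tscale tscale (tensor_space [H S, H T]) (tensor_space [H A, H B]) (com A B \<circ> mul S T)"
    using linear_map_on_compose[OF mul_linear[OF finST dis(2)]] com_linear[OF fin dis(1)] dis(3) by simp
  have L: "linear_map_on tscale tscale (tensor_space ([H S] @ [H T])) (tensor_space [H A, H B])
      (com A B \<circ> mul S T \<circ> tensor_map [H S] [H T] (PsiT k S) id)"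
    using linear_map_on_compose[OF tensor_map_tensor_linear[OF sST P linear_map_on_id]] L0 by simp
  have pure: "com A B (mul S T (tensor_map [H S] [H T] (PsiT k S) id (t \<otimes> u))) =
      (if S \<subseteq> A then tensor_map [H S, H ?C] [H B] (mulT S ?C) id (PsiT k S t \<otimes> comT ?C B u) else 0)"
    if tu: "t \<in> tensor_space [H S]" "u \<in> tensor_space [H T]" for t u
  proof -
    obtain y z where yz: "t = vec y" "y \<in> H S" "u = vec z" "z \<in> H T"
      using tu finST subspace_H by (auto simp: tensor_space_singleton)
    show ?thesis
      using tensor_map_times[OF sST P linear_map_on_id tu]
        com_mul_primitive[OF finST dis(2,1,3) k prim[OF yz(2)] yz(4)]
      by (simp add: yz comT_def)
  qed
  show ?thesis
  proof (cases "S \<subseteq> A")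
    case False
    have Z: "linear_map_on tscale tscale (tensor_space ([H S] @ [H T])) UNIV (\<lambda>t. 0)"
      by (simp add: linear_map_on_def tscale_def zero_fun_apply fun_eq_iff)
    show ?thesis
      using tensor_append_ext[OF L Z _ cx] pure False by simp
  next
    case True
    then have T: "T = ?C \<union> B" "?C \<inter> B = {}" "S \<inter> ?C = {}" "S \<union> ?C = A" "S \<inter> B = {}" using dis by auto
    have finC: "finite ?C" using fin by simp
    have subC: "\<forall>U\<in>set ([H S, H ?C] @ [H B]). subspace U" "\<forall>U\<in>set ([H S] @ [H ?C, H B]). subspace U"
      "\<forall>U\<in>set ([H S] @ [H ?C]). subspace U" "\<forall>U\<in>set ([H A] @ [H B]). subspace U"
      "\<forall>U\<in>set ([H S] @ [H ?C] @ [H B]). subspace U"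
      using finST fin finC subspace_H by auto
    have cT: "tensor_linear [H T] [H ?C, H B] (comT ?C B)"
      using comT_linear[OF finC fin(2) T(2)] by (simp add: T(1)[symmetric])
    have cA: "tensor_linear [H A] [H S, H ?C] (comT S ?C)"
      using comT_linear[OF finST(1) finC T(3)] unfolding T(4) .
    have m: "tensor_linear [H S, H ?C] [H A] (mulT S ?C)"
      using mulT_linear[OF finST(1) finC T(3)] unfolding T(4) .
    have PC: "tensor_linear ([H S] @ [H ?C]) ([H S] @ [H ?C]) (tensor_map [H S] [H ?C] (PsiT k S) id)"
      by (rule tensor_map_tensor_linear[OF subC(3) P linear_map_on_id])
    then have PC: "tensor_linear [H S, H ?C] [H S, H ?C] (tensor_map [H S] [H ?C] (PsiT k S) id)" by simp
    have mlin: "tensor_linear ([H S, H ?C] @ [H B]) ([H A] @ [H B]) (tensor_map [H S, H ?C] [H B] (mulT S ?C) id)"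
      by (rule tensor_map_tensor_linear[OF subC(1) m linear_map_on_id])
    have Plin: "tensor_linear ([H S] @ [H T]) ([H S] @ [H ?C, H B]) (tensor_map [H S] [H T] (PsiT k S) (comT ?C B))"
      by (rule tensor_map_tensor_linear[OF sST P cT])
    have cAB: "com A B x \<in> tensor_space ([H A] @ [H B])"
      using linear_map_on_mem[OF com_linear[OF fin dis(1)] x] by simp
    have cABC: "tensor_map [H A] [H B] (comT S ?C) id (com A B x) \<in> tensor_space ([H S] @ [H ?C] @ [H B])"
      using linear_map_on_mem[OF tensor_map_tensor_linear[OF subC(4) cA linear_map_on_id] cAB] by simp
    have R: "linear_map_on tscale tscale (tensor_space ([H S] @ [H T])) (tensor_space [H A, H B])
        (tensor_map [H S, H ?C] [H B] (mulT S ?C) id \<circ> tensor_map [H S] [H T] (PsiT k S) (comT ?C B))"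
      using linear_map_on_compose[OF Plin] mlin by simp
    have "com A B (Psi_conv k S T x) =
        tensor_map [H S, H ?C] [H B] (mulT S ?C) id (tensor_map [H S] [H T] (PsiT k S) (comT ?C B) (com S T x))"
      using tensor_append_ext[OF L R _ cx] pure True by (simp add: tensor_map_times[OF sST P cT])
    also have "tensor_map [H S] [H T] (PsiT k S) (comT ?C B) (com S T x) =
        tensor_map [H S] [H ?C, H B] (PsiT k S) id (tensor_map [H S] [H T] id (comT ?C B) (com S T x))"
      using tensor_map_compose[OF sST subC(2) linear_map_on_id cT P linear_map_on_id cx] by simp
    \<comment> \<open>Coassociativity for \<open>S\<close>, \<open>A - S\<close>, \<open>B\<close>:
      splitting \<open>T\<close> after \<open>(S, T)\<close> agrees with splitting \<open>A\<close>
      after \<open>(A, B)\<close>.\<close>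
    also have "tensor_map [H S] [H T] id (comT ?C B) (com S T x) = tensor_map [H A] [H B] (comT S ?C) id (com A B x)"
      using coassoc[OF finST(1) finC fin(2) T(3,5,2), of x, unfolded T(4) T(1)[symmetric]] x by simp
    also have "tensor_map [H S] [H ?C, H B] (PsiT k S) id (tensor_map [H A] [H B] (comT S ?C) id (com A B x)) =
        tensor_map [H S, H ?C] [H B] (tensor_map [H S] [H ?C] (PsiT k S) id) id (tensor_map [H A] [H B] (comT S ?C) id (com A B x))"
      using tensor_map_id_right[OF subC(5) P cABC] by simp
    also have "\<dots> = tensor_map [H A] [H B] (tensor_map [H S] [H ?C] (PsiT k S) id \<circ> comT S ?C) (id \<circ> id) (com A B x)"
      by (rule tensor_map_compose[OF subC(4,1) cA linear_map_on_id PC linear_map_on_id cAB])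
    also have "tensor_map [H S, H ?C] [H B] (mulT S ?C) id \<dots> =
        tensor_map [H A] [H B] (mulT S ?C \<circ> (tensor_map [H S] [H ?C] (PsiT k S) id \<circ> comT S ?C)) (id \<circ> (id \<circ> id)) (com A B x)"
      using tensor_map_compose[OF subC(4,1) linear_map_on_compose[OF cA PC] linear_map_on_id m linear_map_on_id cAB]
      by simp
    also have "mulT S ?C \<circ> (tensor_map [H S] [H ?C] (PsiT k S) id \<circ> comT S ?C) = vec \<circ> Psi_conv k S ?C \<circ> unvec"
      by (simp add: fun_eq_iff mulT_def comT_def)
    finally show ?thesis using True by (simp add: comp_def id_def)
  qed
qed

lemma Psi_conv_linear:
  assumes "finite K" "k \<in> S" "S \<subseteq> K"
  shows "linear_map_on scale scale (H K) (H K) (Psi_conv k S (K - S))"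
proof -
  have fin: "finite S" "finite (K - S)" "S \<inter> (K - S) = {}" "S \<union> (K - S) = K"
    using assms by (auto intro: finite_subset)
  have sub: "\<forall>U\<in>set ([H S] @ [H (K - S)]). subspace U" using fin subspace_H by auto
  show ?thesis
    using linear_map_on_compose[OF linear_map_on_compose[OF com_linear[OF fin(1-3)]
        tensor_map_tensor_linear[OF sub PsiT_linear[OF fin(1) assms(2)] linear_map_on_id, simplified]]
        mul_linear[OF fin(1-3)]] fin(4)
    by (simp add: comp_def)
qed

text \<open>The induction step for the case in which \<open>k\<close> lies in the first block;
  \<open>prim\<close> is the induction hypothesis. The terms with proper \<open>S\<close> already
  account for all of \<open>com A B x\<close>, which leaves 0 for \<open>Psi k K x\<close>.\<close>

lemma com_Psi_zero:
  assumes K: "finite K" "k \<in> A" and AB: "A \<union> B = K" "A \<inter> B = {}" "B \<noteq> {}" and x: "x \<in> H K"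
    and prim: "\<And>S y. k \<in> S \<Longrightarrow> S \<subset> K \<Longrightarrow> y \<in> H S \<Longrightarrow> Psi k S y \<in> primitives S"
  shows "com A B (Psi k K x) = 0"
proof -
  have fin: "finite A" "finite B" using K AB by auto
  have k: "k \<in> K" using K AB by auto
  define R where "R = {S. k \<in> S \<and> S \<subset> K}"
  have finR: "finite R" by (rule finite_subset[of _ "Pow K"]) (use K in \<open>auto simp: R_def\<close>)
  note H = subspace_H[OF K(1)]
  have com: "linear_map_on scale tscale (H K) (tensor_space ([H A] @ [H B])) (com A B)"
    using com_linear[OF fin AB(2)] AB(1) by simp
  have conv: "Psi_conv k S (K - S) x \<in> H K" if "S \<in> R" for S
    using linear_map_on_mem[OF Psi_conv_linear[OF K(1)] x] that by (auto simp: R_def)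
  have sub: "\<forall>U\<in>set ([H A] @ [H B]). subspace U" using fin subspace_H by auto
  have cAB: "com A B x \<in> tensor_space ([H A] @ [H B])" by (rule linear_map_on_mem[OF com x])
  let ?Q = "\<lambda>S. vec \<circ> Psi_conv k S (A - S) \<circ> unvec"
  have Q: "tensor_linear [H A] [H A] (?Q S)" if "k \<in> S" "S \<subseteq> A" for S
    by (rule linear_map_on_compose[OF linear_map_on_compose[OF unvec_linear Psi_conv_linear, unfolded o_assoc] vec_linear, unfolded o_assoc])
      (use that fin subspace_H in auto)
  have sum_in: "(\<Sum>S\<in>R. Psi_conv k S (K - S) x) \<in> H K"
    by (rule subspace_sum[OF H conv])
  have "x = Psi k K x + (\<Sum>S\<in>R. Psi_conv k S (K - S) x)"
    using Psi_rec[OF K(1) k x] by (simp add: R_def)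
  then have "com A B x = com A B (Psi k K x) + com A B (\<Sum>S\<in>R. Psi_conv k S (K - S) x)"
    using linear_map_on_add[OF com linear_map_on_mem[OF Psi_linear[OF K(1) k] x] sum_in] by simp
  also have "com A B (\<Sum>S\<in>R. Psi_conv k S (K - S) x) = (\<Sum>S\<in>R. com A B (Psi_conv k S (K - S) x))"
    by (rule linear_map_on_sum[OF com subspace_0[OF H] subspace_add[OF H] conv])
  also have "\<dots> = (\<Sum>S\<in>R. if S \<subseteq> A then tensor_map [H A] [H B] (?Q S) id (com A B x) else 0)"
    by (rule sum.cong[OF refl], rule com_Psi_conv) (use fin AB K x prim in \<open>auto simp: R_def\<close>)
  also have "\<dots> = (\<Sum>S\<in>{S \<in> R. S \<subseteq> A}. tensor_map [H A] [H B] (?Q S) id (com A B x))"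
    by (rule sum.inter_filter[OF finR, symmetric])
  \<comment> \<open>\<open>B\<close> is nonempty, so every subset of \<open>A\<close> is proper in
    \<open>K\<close>: the surviving terms are exactly those of \<open>Psi_conv_sum\<close> for
    \<open>A\<close>, including \<open>S = A\<close>.\<close>
  also have "{S \<in> R. S \<subseteq> A} = {S. k \<in> S \<and> S \<subseteq> A}"
    using AB by (auto simp: R_def)
  also have "(\<Sum>S | k \<in> S \<and> S \<subseteq> A. tensor_map [H A] [H B] (?Q S) id (com A B x)) =
      tensor_map [H A] [H B] (\<lambda>t. \<Sum>S | k \<in> S \<and> S \<subseteq> A. ?Q S t) id (com A B x)"
    by (rule tensor_map_sum_left[OF sub Q linear_map_on_id cAB, symmetric]) auto
  \<comment> \<open>By \<open>Psi_conv_sum\<close> the map on the left factor is the identity on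
    one-fold tensors over \<open>H A\<close>.\<close>
  also have "\<dots> = tensor_map [H A] [H B] id id (com A B x)"
  proof (rule tensor_map_cong[OF sub _ linear_map_on_id _ _ cAB])
    show "tensor_linear [H A] [H A] (\<lambda>t. \<Sum>S | k \<in> S \<and> S \<subseteq> A. ?Q S t)"
      by (rule linear_map_on_sum_fun[OF tensor.vector_space_axioms Q tensor_space_zero tensor_space_add]) auto
    fix t assume "t \<in> tensor_space [H A]"
    then obtain y where y: "t = vec y" "y \<in> H A" using fin subspace_H by (auto simp: tensor_space_singleton)
    have "(\<Sum>S | k \<in> S \<and> S \<subseteq> A. ?Q S t) = vec (\<Sum>S | k \<in> S \<and> S \<subseteq> A. Psi_conv k S (A - S) y)"
      by (subst linear_map_on_sum[OF vec_linear[of UNIV]]) (auto simp: y)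
    then show "(\<Sum>S | k \<in> S \<and> S \<subseteq> A. ?Q S t) = id t"
      by (simp add: Psi_conv_sum[OF fin(1) K(2) y(2)] y)
  qed simp
  also have "\<dots> = com A B x" by (rule tensor_map_id[OF sub cAB])
  finally show ?thesis by simp
qed

end

section \<open>Cocommutativity and the projection property\<close>

context cocommutative_connected_hopf_monoid
begin

text \<open>Strong induction on \<open>K\<close> provides the primitivity on proper subsets that
  \<open>com_Psi_zero\<close> requires. That lemma covers the compositions with \<open>k\<close> in
  the first block, and cocommutativity transfers the vanishing to the others.\<close>

lemma Psi_in_primitives:
  assumes "finite K" "k \<in> K" "x \<in> H K"
  shows "Psi k K x \<in> primitives K"
  using assms
proof (induction K arbitrary: x rule: finite_psubset_induct)
  case (psubset K)
  have prim: "Psi k S y \<in> primitives S" if "k \<in> S" "S \<subset> K" "y \<in> H S" for S y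
    using psubset.IH that by blast
  have Psi_in: "Psi k K x \<in> H K"
    by (rule linear_map_on_mem[OF Psi_linear[OF psubset.hyps psubset.prems(1)] psubset.prems(2)])
  have "com A B (Psi k K x) = 0" if "[A, B] \<in> set_compositions K" for A B
  proof -
    have AB: "A \<union> B = K" "A \<inter> B = {}" "A \<noteq> {}" "B \<noteq> {}"
      using that by (auto simp: set_compositions_Cons set_compositions_Nil)
    have fin: "finite A" "finite B" using AB(1) psubset.hyps by auto
    show ?thesis
    proof (cases "k \<in> A")
      case True
      show ?thesis by (rule com_Psi_zero[OF psubset.hyps True AB(1,2,4) psubset.prems(2) prim])
    next
      case False
      then have "k \<in> B" using AB(1) psubset.prems(1) by auto
      then have "com B A (Psi k K x) = 0"
        by (rule com_Psi_zero[OF psubset.hyps]) (use AB psubset.prems prim in auto)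
      \<comment> \<open>Cocommutativity writes \<open>com A B\<close> as the braiding of
        \<open>com B A\<close>, and the braiding sends 0 to 0.\<close>
      then show ?thesis
        using cocommutative[of B A "Psi k K x"] fin AB Psi_in
          linear_map_on_zero[OF braiding_linear(1)[OF subspace_H subspace_H] tensor_space_zero]
        by (simp add: Un_commute Int_commute)
    qed
  qed
  then show ?case using Psi_in by (simp add: primitives_def)
qed

lemma Psi_projection:
  assumes "finite K" "k \<in> K"
  shows "projection_onto scale (H K) (primitives K) (Psi k K)"
proof -
  \<comment> \<open>Each primitive element is its own preimage.\<close>
  have "primitives K \<subseteq> Psi k K ` H K"
    using Psi_primitive_id[OF assms] by (force simp: primitives_def image_iff)
  then show ?thesis
    using Psi_linear[OF assms] Psi_in_primitives[OF assms] Psi_primitive_id[OF assms]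
    by (auto simp: projection_onto_def)
qed

end

theorem theorem7p1:
  fixes scale :: "'f::field \<Rightarrow> 'v::ab_group_add \<Rightarrow> 'v"
    and H :: "'a set \<Rightarrow> 'v set"
    and act :: "'a set \<Rightarrow> ('a \<Rightarrow> 'a) \<Rightarrow> 'v \<Rightarrow> 'v"
    and mul :: "'a set \<Rightarrow> 'a set \<Rightarrow> ('f, 'v) tensor \<Rightarrow> 'v"
    and com :: "'a set \<Rightarrow> 'a set \<Rightarrow> 'v \<Rightarrow> ('f, 'v) tensor"
    and unit_elt :: 'v
    and counit :: "'v \<Rightarrow> 'f"
    and K :: "'a set"
    and k :: 'a
  assumes "cocommutative_connected_hopf_monoid scale H act mul com unit_elt counit"
    and "finite K"
    and "k \<in> K"
  shows "hopf_data.Psi scale H mul com k K ` H K \<subseteq> hopf_data.primitives H com K \<and>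
    (\<forall>x \<in> hopf_data.primitives H com K. hopf_data.Psi scale H mul com k K x = x) \<and>
    projection_onto scale (H K) (hopf_data.primitives H com K) (hopf_data.Psi scale H mul com k K)"
proof -
  interpret cocommutative_connected_hopf_monoid scale H act mul com unit_elt counit by fact
  show ?thesis
    using Psi_in_primitives[OF assms(2,3)] Psi_primitive_id[OF assms(2,3)] Psi_projection[OF assms(2,3)]
    by auto
qed

end
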